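(* Let $T>0$. Let $\sigma:\mathbb{R}^d\to\mathbb{R}^{d\times m}$ and $b:\mathbb{R}^d\to\mathbb{R}^d$ be continuous and assume there exist constants $C>0$ and $\mu>0$ such that for every integer $N>e$ and all $x,y\in\mathbb{R}^d$ with $|x|,|y|\le N$, $$\|\sigma(x)-\sigma(y)\|\le C\sqrt{\log N}\,|x-y|+C\frac{\log N}{N^{\mu}},\qquad |b(x)-b(y)|\le C\log N\,|x-y|+C\frac{\log N}{N^{\mu}}.$$ Assume the solutions of the SDE $X_t=z+\int_0^t b(X_s)\,ds+\int_0^t\sigma(X_s)\,dW_s$ are conservative (do not explode), and for $z\in\mathbb{R}^d$ denote by $X_t(z)$ the solution starting from $z$. If $x,y\in\mathbb{R}^d$ and $x\ne y$, then almost surely $X_t(x)\ne X_t(y)$ for all $0\le t\le T$.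
   Context: $(\Omega,\mathcal{F},(\mathcal{F}_t),\mathbb{P})$ is a complete filtered probability space with right-continuous filtration containing the null sets, and $(W_t)$ is an $\mathbb{R}^m$-valued standard Brownian motion; both solutions are driven by the same $W$. $|\cdot|$ is the Euclidean norm and $\|\sigma\|^2=\sum_{i,j}\sigma_{ij}^2$. *)

theory Defs
  imports "HOL-Probability.Probability"
begin

definition usual_filtration :: "'w measure \<Rightarrow> (real \<Rightarrow> 'w measure) \<Rightarrow> bool" where
  "usual_filtration M F \<longleftrightarrow>
     (\<forall>t\<ge>0. subalgebra M (F t)) \<and>
     (\<forall>s t. 0 \<le> s \<longrightarrow> s \<le> t \<longrightarrow> sets (F s) \<subseteq> sets (F t)) \<and>
     (\<forall>t\<ge>0. sets (F t) = (\<Inter>s\<in>{t<..}. sets (F s))) \<and>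
     (\<forall>A\<in>null_sets M. \<forall>B. B \<subseteq> A \<longrightarrow> B \<in> sets (F 0))"

definition brownian_motion ::
  "'w measure \<Rightarrow> (real \<Rightarrow> 'w measure) \<Rightarrow> (real \<Rightarrow> 'w \<Rightarrow> real ^ 'm) \<Rightarrow> bool" where
  "brownian_motion M F W \<longleftrightarrow>
     (\<forall>\<omega>\<in>space M. W 0 \<omega> = 0) \<and>
     (\<forall>\<omega>\<in>space M. continuous_on {0..} (\<lambda>t. W t \<omega>)) \<and>
     (\<forall>t\<ge>0. W t \<in> borel_measurable (F t)) \<and>
     (\<forall>s t. 0 \<le> s \<longrightarrow> s < t \<longrightarrow>
        distributed M lborel (\<lambda>\<omega>. W t \<omega> - W s \<omega>)
          (\<lambda>x. ennreal (\<Prod>i\<in>UNIV. normal_density 0 (sqrt (t - s)) (x $ i))) \<and>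
        (\<forall>A\<in>sets (F s). \<forall>B\<in>sets borel.
           measure M (A \<inter> ((\<lambda>\<omega>. W t \<omega> - W s \<omega>) -` B \<inter> space M)) =
           measure M A * measure M ((\<lambda>\<omega>. W t \<omega> - W s \<omega>) -` B \<inter> space M)))"

definition conv_in_prob :: "'w measure \<Rightarrow> (nat \<Rightarrow> 'w \<Rightarrow> 'b::real_normed_vector) \<Rightarrow> ('w \<Rightarrow> 'b) \<Rightarrow> bool" where
  "conv_in_prob M S I \<longleftrightarrow>
     (\<forall>e>0. (\<lambda>n. measure M {\<omega>\<in>space M. norm (S n \<omega> - I \<omega>) > e}) \<longlonglongrightarrow> 0)"

text \<open>Strong solution of X_t = z + int_0^t b(X_s) ds + int_0^t sigma(X_s) dW_s on [0,oo)
  (global, i.e. non-exploding).  The Ito integral of the continuous adapted integrand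
  sigma(X_s) is characterised as the limit in probability of left-point Riemann sums
  over uniform partitions of [0,t].\<close>
definition sde_solution ::
  "'w measure \<Rightarrow> (real \<Rightarrow> 'w measure) \<Rightarrow> (real \<Rightarrow> 'w \<Rightarrow> real ^ 'm)
   \<Rightarrow> (real ^ 'd \<Rightarrow> real ^ 'm ^ 'd) \<Rightarrow> (real ^ 'd \<Rightarrow> real ^ 'd) \<Rightarrow> real ^ 'd
   \<Rightarrow> (real \<Rightarrow> 'w \<Rightarrow> real ^ 'd) \<Rightarrow> bool" where
  "sde_solution M F W \<sigma> b z X \<longleftrightarrow>
     (\<forall>t\<ge>0. X t \<in> borel_measurable (F t)) \<and>
     (\<forall>\<omega>\<in>space M. continuous_on {0..} (\<lambda>t. X t \<omega>)) \<and>
     (\<exists>I :: real \<Rightarrow> 'w \<Rightarrow> real ^ 'd.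
        (\<forall>t\<ge>0. conv_in_prob M
           (\<lambda>n \<omega>. \<Sum>k<n. \<sigma> (X (t * real k / real n) \<omega>) *v
                       (W (t * real (Suc k) / real n) \<omega> - W (t * real k / real n) \<omega>))
           (I t)) \<and>
        (\<forall>t\<ge>0. AE \<omega> in M. X t \<omega> = z + integral {0..t} (\<lambda>s. b (X s \<omega>)) + I t \<omega>))"

end

theory Submission
  imports Defs
begin

text \<open>
  Write \<open>\<eta> = X - Y\<close>. For bounded arguments at distance \<open>r\<close>, choosing \<open>N\<close> of order
  \<open>r powr (- 2 / \<mu>)\<close> turns the hypotheses into
  \<open>\<bar>\<sigma> u - \<sigma> v\<bar>\<^sup>2 \<le> K r\<^sup>2 L\<close> and \<open>\<bar>b u - b v\<bar> \<le> K r L\<close> with \<open>L = 1 + ln (1 + 1 / r\<^sup>2)\<close>. Under these bounds the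
  generator maps \<open>L\<close> to at most a constant multiple of \<open>L\<close>, so by Gronwall the expectation of \<open>L\<close> stays bounded
  up to the time where \<open>\<bar>\<eta>\<bar>\<close> falls below \<open>\<epsilon>\<close>. As \<open>L\<close> blows up at the origin, letting \<open>\<epsilon>\<close> tend to \<open>0\<close> shows that
  \<open>\<eta>\<close> almost surely does not reach the origin.

  Ito's formula is avoided. The argument runs on Euler sums of \<open>\<eta>\<close> over a uniform grid, with coefficients
  evaluated along the true solutions, so that one step is a Gaussian perturbation and a quadratic estimate for \<open>L\<close>
  suffices. Comparing two nested grids by a maximal inequality shows that these sums converge to \<open>\<eta>\<close> uniformly over
  the grid, in probability.
\<close>

section \<open>Brownian increments\<close>

text \<open>The stochastic integral is known only as a limit in probability at each fixed time.
  Stopping is therefore done on discrete sums: coefficients are set to zero from the first bad index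
  on, which keeps them adapted and bounded, so that Gaussian moments suffice to average one step.
  The logarithm is the borderline case. In \<open>\<xi> = r\<^sup>2\<close> the derivative of
  \<open>L\<close> is \<open>- 1 / (\<xi> * (1 + \<xi>))\<close>, which compensates the factors
  \<open>r\<^sup>2\<close> of the coefficient bounds and leaves a multiple of \<open>L\<close>, just
  what Gronwall tolerates. A mismatch shapes the estimates: the coefficients are controlled by the
  true \<open>\<eta>\<close>, while \<open>L\<close> is evaluated along the Euler sum
  \<open>Z\<close>. As long as \<open>norm (Z - \<eta>) \<le> \<epsilon> \<le> norm \<eta>\<close>,
  the regularised \<open>(norm Z)\<^sup>2 + \<epsilon>\<^sup>2\<close> is comparable to
  \<open>(norm \<eta>)\<^sup>2\<close>, and it also keeps \<open>L\<close> bounded. The price is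
  remainders with negative powers of \<open>\<epsilon>\<close>. They vanish with the mesh while
  \<open>\<epsilon>\<close> is fixed, and the Gronwall exponent is free of
  \<open>\<epsilon>\<close>; this dictates the order of the limits.\<close>

lemma norm_matrix_vector_mult_le:
  fixes A :: "real ^ 'm ^ 'd" and x :: "real ^ 'm"
  shows "norm (A *v x) \<le> norm A * norm x"
proof -
  \<comment> \<open>The norm of a matrix is the Euclidean norm of its row norms, hence the
    Hilbert-Schmidt norm, so Cauchy-Schwarz row by row is enough.\<close>
  have c: "\<bar>(A *v x) $ i\<bar> \<le> norm (A $ i) * norm x" for i
    using Cauchy_Schwarz_ineq2[of "A $ i" x]
    by (simp add: matrix_vector_mult_def inner_vec_def)
  have "norm (A *v x) \<le> L2_set (\<lambda>i. norm (A $ i) * norm x) UNIV"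
    unfolding norm_vec_def[of "A *v x"] using c by (intro L2_set_mono) auto
  also have "\<dots> = norm A * norm x"
    unfolding norm_vec_def[of A] by (simp add: L2_set_left_distrib)
  finally show ?thesis .
qed

text \<open>Duality: pairing \<open>v v* A\<close> with itself moves \<open>A\<close> to the other
  side, and one factor of the norm cancels.\<close>

lemma norm_vector_matrix_mult_le:
  fixes A :: "real ^ 'm ^ 'd" and v :: "real ^ 'd"
  shows "norm (v v* A) \<le> norm v * norm A"
proof (cases "v v* A = 0")
  case False
  have "norm (v v* A) * norm (v v* A) = v \<bullet> (A *v (v v* A))"
    by (metis dot_lmul_matrix power2_norm_eq_inner power2_eq_square)
  also have "\<dots> \<le> norm v * (norm A * norm (v v* A))"
    using norm_matrix_vector_mult_le[of A "v v* A"]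
    by (meson mult_left_mono norm_cauchy_schwarz norm_ge_zero order_trans)
  finally show ?thesis using False by simp
qed simp

lemma bounded_bilinear_matrix_vector_mult:
  "bounded_bilinear ((*v) :: real ^ 'm ^ 'd \<Rightarrow> real ^ 'm \<Rightarrow> real ^ 'd)"
proof
  show "\<exists>K. \<forall>(A :: real ^ 'm ^ 'd) x. norm (A *v x) \<le> norm A * norm x * K"
    by (rule exI[of _ 1]) (simp add: norm_matrix_vector_mult_le)
qed (simp_all add: matrix_vector_right_distrib matrix_vector_mult_add_rdistrib
      matrix_scaleR_vector_ac scaleR_matrix_vector_assoc)

lemma bounded_bilinear_vector_matrix_mult:
  "bounded_bilinear ((v*) :: real ^ 'd \<Rightarrow> real ^ 'm ^ 'd \<Rightarrow> real ^ 'm)"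
proof
  show "\<exists>K. \<forall>v (A :: real ^ 'm ^ 'd). norm (v v* A) \<le> norm v * norm A * K"
    by (rule exI[of _ 1]) (simp add: norm_vector_matrix_mult_le)
qed (simp_all add: vec_eq_iff vector_matrix_mult_def algebra_simps sum.distrib sum_distrib_left)

lemma borel_measurable_matrix_vector_mult [measurable (raw)]:
  fixes A :: "'w \<Rightarrow> real ^ 'm ^ 'd" and v :: "'w \<Rightarrow> real ^ 'm"
  assumes "A \<in> borel_measurable N" and "v \<in> borel_measurable N"
  shows "(\<lambda>\<omega>. A \<omega> *v v \<omega>) \<in> borel_measurable N"
  by (intro borel_measurable_continuous_Pair[OF assms]
      bounded_bilinear.continuous_on[OF bounded_bilinear_matrix_vector_mult] continuous_intros)

lemma borel_measurable_vector_matrix_mult [measurable (raw)]: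
  fixes A :: "'w \<Rightarrow> real ^ 'm ^ 'd" and v :: "'w \<Rightarrow> real ^ 'd"
  assumes "v \<in> borel_measurable N" and "A \<in> borel_measurable N"
  shows "(\<lambda>\<omega>. v \<omega> v* A \<omega>) \<in> borel_measurable N"
  by (intro borel_measurable_continuous_Pair[OF assms]
      bounded_bilinear.continuous_on[OF bounded_bilinear_vector_matrix_mult] continuous_intros)

lemma borel_measurable_vec_nth_comp [measurable (raw)]:
  fixes v :: "'w \<Rightarrow> real ^ 'm"
  assumes "v \<in> borel_measurable N"
  shows "(\<lambda>\<omega>. v \<omega> $ i) \<in> borel_measurable N"
proof -
  have "(\<lambda>\<omega>. v \<omega> \<bullet> axis i 1) \<in> borel_measurable N"
    using assms by measurable
  then show ?thesis by (simp add: inner_axis)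
qed

section \<open>Gaussian law and moments of the increments\<close>

lemma nn_integral_normal_density:
  "0 < s \<Longrightarrow> (\<integral>\<^sup>+x. ennreal (normal_density 0 s x) \<partial>lborel) = 1"
  by (simp add: nn_integral_eq_integral integrable_normal_density)

text \<open>Increments are specified by their joint density. A test function of coordinate
  \<open>j\<close> keeps the integrand a product, so the integral factors and every other coordinate
  contributes \<open>1\<close>.\<close>

lemma distributed_component_normal:
  fixes D :: "'w \<Rightarrow> real ^ 'm"
  assumes s: "0 < s"
    and D: "distributed M lborel D (\<lambda>x. ennreal (\<Prod>i\<in>UNIV. normal_density 0 s (x $ i)))"
  shows "distributed M lborel (\<lambda>\<omega>. D \<omega> $ j) (normal_density 0 s)"
proof -
  have Dm [measurable]: "D \<in> borel_measurable M"
    using distributed_measurable[OF D] by simp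
  have Basis_eq: "(Basis :: (real ^ 'm) set) = range (\<lambda>i. axis i 1)"
    by (auto simp: Basis_vec_def)
  have inj: "inj (\<lambda>i. axis i 1 :: real ^ 'm)"
    by (auto simp: inj_on_def axis_eq_axis)
  have nn: "(\<integral>\<^sup>+\<omega>. g (D \<omega> $ j) \<partial>M) = (\<integral>\<^sup>+x. ennreal (normal_density 0 s x) * g x \<partial>lborel)"
    if g [measurable]: "g \<in> borel_measurable borel" for g :: "real \<Rightarrow> ennreal"
  proof -
    \<comment> \<open>The test function is folded into the factor at \<open>axis j 1\<close>, which
      gives the product over \<open>Basis\<close> that Fubini for \<open>lborel\<close>
      expects.\<close>
    define f :: "real ^ 'm \<Rightarrow> real \<Rightarrow> ennreal" where
      "f b y = ennreal (normal_density 0 s y) * (if b = axis j 1 then g y else 1)" for b y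
    have "(\<integral>\<^sup>+\<omega>. g (D \<omega> $ j) \<partial>M) =
        (\<integral>\<^sup>+x. ennreal (\<Prod>i\<in>UNIV. normal_density 0 s (x $ i)) * g (x $ j) \<partial>lborel)"
      by (subst distributed_nn_integral[OF D]) auto
    also have "\<dots> = (\<integral>\<^sup>+x. (\<Prod>b\<in>Basis. f b (x \<bullet> b)) \<partial>(lborel :: (real ^ 'm) measure))"
    proof (intro nn_integral_cong)
      fix x :: "real ^ 'm"
      have "(\<Prod>b\<in>Basis. f b (x \<bullet> b)) = (\<Prod>i\<in>UNIV. f (axis i 1) (x $ i))"
        unfolding Basis_eq by (subst prod.reindex[OF inj]) (simp add: inner_axis)
      also have "\<dots> = (\<Prod>i\<in>UNIV. ennreal (normal_density 0 s (x $ i))) *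
          (\<Prod>i\<in>UNIV. if i = j then g (x $ i) else 1)"
        unfolding f_def by (subst prod.distrib) (simp add: axis_eq_axis)
      also have "(\<Prod>i\<in>UNIV. if i = j then g (x $ i) else 1) = g (x $ j)"
        by (simp add: prod.delta)
      also have "(\<Prod>i\<in>UNIV. ennreal (normal_density 0 s (x $ i))) =
          ennreal (\<Prod>i\<in>UNIV. normal_density 0 s (x $ i))"
        by (simp add: prod_ennreal)
      finally show "ennreal (\<Prod>i\<in>UNIV. normal_density 0 s (x $ i)) * g (x $ j) =
          (\<Prod>b\<in>Basis. f b (x \<bullet> b))" by simp
    qed
    also have "\<dots> = (\<Prod>b\<in>(Basis :: (real ^ 'm) set). \<integral>\<^sup>+y. f b y \<partial>lborel)"
      by (rule nn_integral_lborel_prod) (auto simp: f_def)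
    also have "\<dots> = (\<Prod>i\<in>UNIV. \<integral>\<^sup>+y. f (axis i 1) y \<partial>lborel)"
      unfolding Basis_eq by (subst prod.reindex[OF inj]) simp
    also have "\<dots> = (\<Prod>i\<in>UNIV. if i = j then
        (\<integral>\<^sup>+x. ennreal (normal_density 0 s x) * g x \<partial>lborel) else 1)"
      by (intro prod.cong) (auto simp: f_def axis_eq_axis nn_integral_normal_density[OF s])
    finally show ?thesis by (simp add: prod.delta)
  qed
  show ?thesis
    unfolding distributed_def
  proof (intro conjI measure_eqI)
    fix A assume "A \<in> sets (distr M lborel (\<lambda>\<omega>. D \<omega> $ j))"
    then have A [measurable]: "A \<in> sets borel" by simp
    have "emeasure (distr M lborel (\<lambda>\<omega>. D \<omega> $ j)) A = (\<integral>\<^sup>+\<omega>. indicator A (D \<omega> $ j) \<partial>M)"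
      using nn_integral_distr[of "\<lambda>\<omega>. D \<omega> $ j" M lborel "indicator A"] by simp
    then show "emeasure (distr M lborel (\<lambda>\<omega>. D \<omega> $ j)) A =
        emeasure (density lborel (\<lambda>x. ennreal (normal_density 0 s x))) A"
      by (simp add: nn emeasure_density)
  qed auto
qed

locale filtered_brownian_motion = prob_space M
  for M :: "'w measure" and F :: "real \<Rightarrow> 'w measure" and W :: "real \<Rightarrow> 'w \<Rightarrow> real ^ 'm" +
  assumes usual: "usual_filtration M F" and bm: "brownian_motion M F W"
begin

lemma subalgebra_F: "0 \<le> t \<Longrightarrow> subalgebra M (F t)"
  using usual by (simp add: usual_filtration_def)

lemma space_F: "0 \<le> t \<Longrightarrow> space (F t) = space M"
  using subalgebra_F by (simp add: subalgebra_def)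

lemma sets_F_subset_events: "0 \<le> t \<Longrightarrow> sets (F t) \<subseteq> events"
  using subalgebra_F by (simp add: subalgebra_def)

lemma sets_F_mono: "0 \<le> s \<Longrightarrow> s \<le> t \<Longrightarrow> sets (F s) \<subseteq> sets (F t)"
  using usual unfolding usual_filtration_def by blast

lemma measurable_F_mono:
  "0 \<le> s \<Longrightarrow> s \<le> t \<Longrightarrow> f \<in> measurable (F s) N \<Longrightarrow> f \<in> measurable (F t) N"
  by (rule measurable_from_subalg[of "F t" "F s"])
    (use sets_F_mono in \<open>auto simp: subalgebra_def space_F\<close>)

lemma measurable_F_M: "0 \<le> s \<Longrightarrow> f \<in> measurable (F s) N \<Longrightarrow> f \<in> measurable M N"
  by (rule measurable_from_subalg[OF subalgebra_F])

text \<open>Subsets of null sets already lie in \<open>F 0\<close>, so \<open>M\<close> is complete.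
  This serves events formed with a stochastic integral that is not assumed measurable.\<close>

lemma null_subset_event:
  assumes "A \<in> null_sets M" and "B \<subseteq> A" shows "B \<in> events"
proof -
  have "B \<in> sets (F 0)" using usual assms unfolding usual_filtration_def by blast
  then show ?thesis using sets_F_subset_events[of 0] by auto
qed

lemma W_measurable_F: "0 \<le> t \<Longrightarrow> W t \<in> borel_measurable (F t)"
  using bm by (simp add: brownian_motion_def)

lemma W_measurable: "0 \<le> t \<Longrightarrow> W t \<in> borel_measurable M"
  by (rule measurable_F_M[OF _ W_measurable_F])

lemma increment_measurable [measurable]:
  "0 \<le> s \<Longrightarrow> s < t \<Longrightarrow> (\<lambda>\<omega>. W t \<omega> - W s \<omega>) \<in> borel_measurable M"
  by (intro borel_measurable_diff W_measurable) auto

lemma increment_component_normal: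
  assumes "0 \<le> s" and "s < t"
  shows "distributed M lborel (\<lambda>\<omega>. (W t \<omega> - W s \<omega>) $ j) (normal_density 0 (sqrt (t - s)))"
  by (rule distributed_component_normal) (use bm assms in \<open>auto simp: brownian_motion_def\<close>)

lemma increment_moment:
  assumes st: "0 \<le> s" "s < t"
  shows "integrable M (\<lambda>\<omega>. ((W t \<omega> - W s \<omega>) $ j) ^ k)"
    and "expectation (\<lambda>\<omega>. ((W t \<omega> - W s \<omega>) $ j) ^ k) =
      integral\<^sup>L lborel (\<lambda>x. normal_density 0 (sqrt (t - s)) x * x ^ k)"
proof -
  note d = increment_component_normal[OF st, of j]
  show "integrable M (\<lambda>\<omega>. ((W t \<omega> - W s \<omega>) $ j) ^ k)"
    using distributed_integrable[OF d, of "\<lambda>x. x ^ k"] integrable_normal_moment[of "sqrt (t - s)" 0 k] st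
    by simp
  show "expectation (\<lambda>\<omega>. ((W t \<omega> - W s \<omega>) $ j) ^ k) =
      integral\<^sup>L lborel (\<lambda>x. normal_density 0 (sqrt (t - s)) x * x ^ k)"
    by (rule distributed_integral[OF d, of "\<lambda>x. x ^ k", symmetric]) auto
qed

lemma increment_moments:
  assumes st: "0 \<le> s" "s < t"
  shows "expectation (\<lambda>\<omega>. (W t \<omega> - W s \<omega>) $ j) = 0"
    and "expectation (\<lambda>\<omega>. ((W t \<omega> - W s \<omega>) $ j)\<^sup>2) = t - s"
    and "expectation (\<lambda>\<omega>. ((W t \<omega> - W s \<omega>) $ j) ^ 4) = 3 * (t - s)\<^sup>2"
  using increment_moment(2)[OF st, of j 1] increment_moment(2)[OF st, of j 2]
    increment_moment(2)[OF st, of j 4]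
    integral_normal_moment_odd[of "sqrt (t - s)" 0 0]
    integral_normal_moment_even[of "sqrt (t - s)" 0 1]
    integral_normal_moment_even[of "sqrt (t - s)" 0 2] st
  by (simp_all add: fact_numeral power2_eq_square field_simps)

text \<open>Second moments add up exactly over the coordinates. For the fourth moment only the order
  \<open>(t - s)\<^sup>2\<close> matters: summed over \<open>n\<close> steps of length
  \<open>T / n\<close>, such terms vanish in the limit.\<close>

lemma norm_increment_moments:
  fixes s t :: real
  assumes st: "0 \<le> s" "s < t"
  shows "integrable M (\<lambda>\<omega>. (norm (W t \<omega> - W s \<omega>))\<^sup>2)"
    and "expectation (\<lambda>\<omega>. (norm (W t \<omega> - W s \<omega>))\<^sup>2) = CARD('m) * (t - s)"
    and "integrable M (\<lambda>\<omega>. norm (W t \<omega> - W s \<omega>) ^ 4)"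
    and "expectation (\<lambda>\<omega>. norm (W t \<omega> - W s \<omega>) ^ 4) \<le> 3 * (real CARD('m))\<^sup>2 * (t - s)\<^sup>2"
proof -
  let ?D = "\<lambda>\<omega>. W t \<omega> - W s \<omega>"
  have n2: "(norm v)\<^sup>2 = (\<Sum>j\<in>UNIV. (v $ j)\<^sup>2)" for v :: "real ^ 'm"
    by (simp only: power2_norm_eq_inner inner_vec_def) (simp add: power2_eq_square)
  \<comment> \<open>Cauchy-Schwarz costs one factor \<open>CARD('m)\<close>; summing the fourth
    moments of the coordinates yields the other.\<close>
  have n4: "norm v ^ 4 \<le> CARD('m) * (\<Sum>j\<in>UNIV. (v $ j) ^ 4)" for v :: "real ^ 'm"
  proof -
    have "norm v ^ 4 = (\<Sum>j\<in>UNIV. (v $ j)\<^sup>2)\<^sup>2"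
      unfolding n2[symmetric] by simp
    also have "\<dots> \<le> CARD('m) * (\<Sum>j\<in>UNIV. ((v $ j)\<^sup>2)\<^sup>2)"
      using sum_squared_le_sum_of_squares[of "\<lambda>j. (v $ j)\<^sup>2" UNIV] by (simp add: mult.commute)
    finally show ?thesis by simp
  qed
  note i = increment_moment(1)[OF st]
  show i2: "integrable M (\<lambda>\<omega>. (norm (?D \<omega>))\<^sup>2)"
    unfolding n2 using i by (intro Bochner_Integration.integrable_sum)
  show "expectation (\<lambda>\<omega>. (norm (?D \<omega>))\<^sup>2) = CARD('m) * (t - s)"
    unfolding n2 using i by (subst Bochner_Integration.integral_sum) (auto simp only: increment_moments[OF st] sum_constant)
  have i4: "integrable M (\<lambda>\<omega>. CARD('m) * (\<Sum>j\<in>UNIV. (?D \<omega> $ j) ^ 4))"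
    using i by (intro integrable_mult_right Bochner_Integration.integrable_sum)
  show i4': "integrable M (\<lambda>\<omega>. norm (?D \<omega>) ^ 4)"
    by (rule Bochner_Integration.integrable_bound[OF i4])
      (use st n4 in \<open>auto intro!: AE_I2 order_trans[OF n4] simp del: vector_minus_component\<close>)
  have "expectation (\<lambda>\<omega>. norm (?D \<omega>) ^ 4) \<le> expectation (\<lambda>\<omega>. CARD('m) * (\<Sum>j\<in>UNIV. (?D \<omega> $ j) ^ 4))"
    by (intro integral_mono[OF i4' i4] n4)
  also have "\<dots> = CARD('m) * (\<Sum>j\<in>(UNIV::'m set). 3 * (t - s)\<^sup>2)"
    using i by (simp add: Bochner_Integration.integral_sum increment_moments[OF st] del: vector_minus_component)
  finally show "expectation (\<lambda>\<omega>. norm (?D \<omega>) ^ 4) \<le> 3 * (real CARD('m))\<^sup>2 * (t - s)\<^sup>2"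
    by (simp add: power2_eq_square mult_ac)
qed

text \<open>Independence in \<open>brownian_motion\<close> is stated for single events. It passes to
  random variables because an event about \<open>\<phi>\<close> of the increment is an event about
  the increment itself.\<close>

lemma indep_increment:
  fixes G :: "'w \<Rightarrow> real" and \<phi> :: "real ^ 'm \<Rightarrow> real"
  assumes st: "0 \<le> s" "s < t"
    and G: "G \<in> borel_measurable (F s)" and \<phi>: "\<phi> \<in> borel_measurable borel"
  shows "indep_var borel G borel (\<lambda>\<omega>. \<phi> (W t \<omega> - W s \<omega>))"
proof -
  let ?D = "\<lambda>\<omega>. W t \<omega> - W s \<omega>"
  let ?E = "\<lambda>\<omega>. \<phi> (?D \<omega>)"
  have Em: "?E \<in> borel_measurable M"
    using \<phi> st by measurable
  have GM: "G \<in> borel_measurable M" using G st by (intro measurable_F_M)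
  have subG: "sigma_sets (space M) {G -` A \<inter> space M |A. A \<in> sets borel} \<subseteq> sets (F s)"
    unfolding space_F[OF st(1), symmetric]
    by (intro sets.sigma_sets_subset) (use G in \<open>auto intro: measurable_sets\<close>)
  \<comment> \<open>Preimages of Borel sets already form a sigma-algebra, so every generated event
    is a preimage.\<close>
  have eqE: "sigma_sets (space M) {?E -` A \<inter> space M |A. A \<in> sets borel} =
      {?E -` A \<inter> space M |A. A \<in> sets borel}"
    using sigma_sets_vimage_commute[of ?E "space M" UNIV "sets borel"]
      sets.sigma_sets_eq[of "borel :: real measure"]
    by simp
  show ?thesis
    unfolding indep_var_eq
  proof (intro conjI indep_setI)
    fix a b assume "a \<in> sigma_sets (space M) {G -` A \<inter> space M |A. A \<in> sets borel}"
      and "b \<in> sigma_sets (space M) {?E -` A \<inter> space M |A. A \<in> sets borel}"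
    then obtain B where "a \<in> sets (F s)" "B \<in> sets borel" "b = ?E -` B \<inter> space M"
      using subG unfolding eqE by auto
    then have "a \<in> sets (F s)" "\<phi> -` B \<in> sets borel" "b = ?D -` (\<phi> -` B) \<inter> space M"
      using measurable_sets[OF \<phi>, of B] by auto
    then show "prob (a \<inter> b) = prob a * prob b"
      using bm st unfolding brownian_motion_def by blast
  next
    show "sigma_sets (space M) {G -` A \<inter> space M |A. A \<in> sets borel} \<subseteq> events"
      using subG sets_F_subset_events[OF st(1)] by auto
    show "sigma_sets (space M) {?E -` A \<inter> space M |A. A \<in> sets borel} \<subseteq> events"
      unfolding eqE using Em by (auto intro: measurable_sets)
  qed (fact GM Em)+
qed

lemma expectation_mult_increment:
  fixes G :: "'w \<Rightarrow> real" and \<phi> :: "real ^ 'm \<Rightarrow> real"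
  assumes "0 \<le> s" "s < t" "G \<in> borel_measurable (F s)" "\<phi> \<in> borel_measurable borel"
    and "integrable M G" "integrable M (\<lambda>\<omega>. \<phi> (W t \<omega> - W s \<omega>))"
  shows "integrable M (\<lambda>\<omega>. G \<omega> * \<phi> (W t \<omega> - W s \<omega>))"
    and "expectation (\<lambda>\<omega>. G \<omega> * \<phi> (W t \<omega> - W s \<omega>)) =
      expectation G * expectation (\<lambda>\<omega>. \<phi> (W t \<omega> - W s \<omega>))"
  using indep_var_integrable[OF indep_increment[OF assms(1-4)] assms(5,6)]
    indep_var_lebesgue_integral[OF indep_increment[OF assms(1-4)] assms(5,6)] by simp_all

text \<open>In each coordinate a bounded factor known at time \<open>s\<close> multiplies an
  independent centred increment. This discrete martingale property removes the first-order noise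
  terms.\<close>

lemma inner_increment:
  fixes g :: "'w \<Rightarrow> real ^ 'm"
  assumes st: "0 \<le> s" "s < t" and g: "g \<in> borel_measurable (F s)"
    and c: "\<And>\<omega>. \<omega> \<in> space M \<Longrightarrow> norm (g \<omega>) \<le> c"
  shows "integrable M (\<lambda>\<omega>. g \<omega> \<bullet> (W t \<omega> - W s \<omega>))"
    and "expectation (\<lambda>\<omega>. g \<omega> \<bullet> (W t \<omega> - W s \<omega>)) = 0"
proof -
  let ?D = "\<lambda>\<omega>. W t \<omega> - W s \<omega>"
  have gi: "integrable M (\<lambda>\<omega>. g \<omega> $ j)" for j
    by (rule integrable_const_bound[of _ c])
      (use c component_le_norm_cart[of _ j] g st in \<open>auto intro!: AE_I2 measurable_F_M[OF st(1)] intro: order_trans\<close>)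
  have eq: "g \<omega> \<bullet> ?D \<omega> = (\<Sum>j\<in>UNIV. g \<omega> $ j * (?D \<omega> $ j))" for \<omega>
    by (simp add: inner_vec_def)
  have Di: "integrable M (\<lambda>\<omega>. ?D \<omega> $ j)" for j
    using increment_moment(1)[OF st, of j 1] by simp
  note m = expectation_mult_increment[OF st _ _ gi Di]
  have i: "integrable M (\<lambda>\<omega>. g \<omega> $ j * (?D \<omega> $ j))" for j
    by (rule m(1)) (use g in measurable)
  have e: "expectation (\<lambda>\<omega>. g \<omega> $ j * (?D \<omega> $ j)) = 0" for j
    by (subst m(2)) (use g in \<open>simp_all add: increment_moments(1)[OF st] del: vector_minus_component\<close>)
  show "integrable M (\<lambda>\<omega>. g \<omega> \<bullet> ?D \<omega>)"
    unfolding eq by (intro Bochner_Integration.integrable_sum i)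
  show "expectation (\<lambda>\<omega>. g \<omega> \<bullet> ?D \<omega>) = 0"
    unfolding eq by (subst Bochner_Integration.integral_sum[OF i]) (simp only: e sum.neutral_const)
qed

text \<open>Common core of both expectation recursions: constant \<open>V\<close> and
  \<open>e = r = 0\<close> for the squared norm in the maximal inequality, and \<open>V\<close> a
  multiple of the Lyapunov value with genuine remainders for the main estimate.\<close>

lemma expectation_step_le:
  fixes g :: "'w \<Rightarrow> real ^ 'm" and U U' V :: "'w \<Rightarrow> real" and e r s t :: real
  assumes st: "0 \<le> s" "s < t" and g: "g \<in> borel_measurable (F s)"
    and c: "\<And>\<omega>. \<omega> \<in> space M \<Longrightarrow> norm (g \<omega>) \<le> c"
    and V: "V \<in> borel_measurable (F s)" "integrable M V"
    and U: "integrable M U" "integrable M U'" and e: "0 \<le> e"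
    and step: "\<And>\<omega>. \<omega> \<in> space M \<Longrightarrow> U' \<omega> \<le> U \<omega> + g \<omega> \<bullet> (W t \<omega> - W s \<omega>)
      + V \<omega> * (norm (W t \<omega> - W s \<omega>))\<^sup>2 + e * norm (W t \<omega> - W s \<omega>) ^ 4 + r"
  shows "expectation U' \<le> expectation U + expectation V * (CARD('m) * (t - s))
      + e * (3 * (real CARD('m))\<^sup>2 * (t - s)\<^sup>2) + r"
proof -
  let ?D = "\<lambda>\<omega>. W t \<omega> - W s \<omega>"
  note n = norm_increment_moments[OF st]
  have Vi: "integrable M (\<lambda>\<omega>. V \<omega> * (norm (?D \<omega>))\<^sup>2)"
    by (rule expectation_mult_increment(1)[OF st V(1) _ V(2) n(1)]) measurable
  have Ve: "expectation (\<lambda>\<omega>. V \<omega> * (norm (?D \<omega>))\<^sup>2) = expectation V * (CARD('m) * (t - s))"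
    by (subst expectation_mult_increment(2)[OF st V(1) _ V(2) n(1)]) (simp_all add: n(2))
  note gi = inner_increment[OF st g c]
  have "expectation U' \<le> expectation (\<lambda>\<omega>. U \<omega> + g \<omega> \<bullet> ?D \<omega> + V \<omega> * (norm (?D \<omega>))\<^sup>2 + e * norm (?D \<omega>) ^ 4 + r)"
    using U gi(1) Vi n(3) step by (intro integral_mono) auto
  also have "\<dots> = expectation U + expectation V * (CARD('m) * (t - s)) + e * expectation (\<lambda>\<omega>. norm (?D \<omega>) ^ 4) + r"
    using U gi Vi n(3) by (simp add: Ve prob_space)
  also have "\<dots> \<le> expectation U + expectation V * (CARD('m) * (t - s)) + e * (3 * (real CARD('m))\<^sup>2 * (t - s)\<^sup>2) + r"
    using mult_left_mono[OF n(4) e] by simp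
  finally show ?thesis .
qed

end

section \<open>Sums against Brownian increments and Riemann sums\<close>

text \<open>If \<open>good\<close> fails at \<open>k\<close>, increment \<open>k\<close> and all
  later ones vanish. The step that led to the bad index is still counted, so the sum is frozen at
  its value at \<open>k\<close>; for \<open>k = n\<close> the status of \<open>good n\<close> is
  left open.\<close>

lemma sum_stopped:
  fixes d :: "nat \<Rightarrow> 'a::comm_monoid_add"
  assumes "\<And>j. j < k \<Longrightarrow> good j" and "k \<le> n" and "k = n \<or> \<not> good k"
  shows "(\<Sum>i<n. if \<forall>j\<le>i. good j then d i else 0) = (\<Sum>i<k. d i)"
proof -
  have "(\<Sum>i<n. if \<forall>j\<le>i. good j then d i else 0) = (\<Sum>i<k. if \<forall>j\<le>i. good j then d i else 0)"
    using assms by (intro sum.mono_neutral_right) (auto simp: not_less)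
  also have "\<dots> = (\<Sum>i<k. d i)"
    using assms(1) by (intro sum.cong) auto
  finally show ?thesis .
qed

context filtered_brownian_motion
begin

lemma brownian_sum_measurable:
  fixes B :: "nat \<Rightarrow> 'w \<Rightarrow> real ^ 'm ^ 'd" and \<tau> :: "nat \<Rightarrow> real"
  assumes \<tau>: "strict_mono \<tau>" "0 \<le> \<tau> 0"
    and B: "\<And>i. i < k \<Longrightarrow> B i \<in> borel_measurable (F (\<tau> i))"
  shows "(\<lambda>\<omega>. \<Sum>i<k. B i \<omega> *v (W (\<tau> (Suc i)) \<omega> - W (\<tau> i) \<omega>)) \<in> borel_measurable (F (\<tau> k))"
proof (intro borel_measurable_sum borel_measurable_matrix_vector_mult borel_measurable_diff)
  fix i assume "i \<in> {..<k}"
  then have i: "i < k" by simp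
  have t: "0 \<le> \<tau> j" for j
    using \<tau> by (meson strict_mono_less_eq le0 order_trans)
  have le: "\<tau> i \<le> \<tau> k" "\<tau> (Suc i) \<le> \<tau> k" using \<tau>(1) i by (auto simp: strict_mono_less_eq)
  show "B i \<in> borel_measurable (F (\<tau> k))" using measurable_F_mono[OF t le(1) B[OF i]] .
  show "W (\<tau> (Suc i)) \<in> borel_measurable (F (\<tau> k))"
    using measurable_F_mono[OF t le(2) W_measurable_F[OF t]] .
  show "W (\<tau> i) \<in> borel_measurable (F (\<tau> k))"
    using measurable_F_mono[OF t le(1) W_measurable_F[OF t]] .
qed

text \<open>Kolmogorov's argument: the sum is frozen at the first index where it exceeds \<open>\<epsilon>\<close> or where
  the coefficient exceeds \<open>\<delta>\<close>, so that all cross terms have bounded coefficients.\<close>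

lemma brownian_sum_maximal_inequality:
  fixes B :: "nat \<Rightarrow> 'w \<Rightarrow> real ^ 'm ^ 'd" and \<tau> :: "nat \<Rightarrow> real" and \<delta> \<epsilon> :: real
  assumes \<tau>: "strict_mono \<tau>" "0 \<le> \<tau> 0"
    and B: "\<And>i. B i \<in> borel_measurable (F (\<tau> i))"
    and \<delta>: "0 \<le> \<delta>" and \<epsilon>: "0 < \<epsilon>"
  shows "prob {\<omega>\<in>space M. \<exists>k\<le>n. norm (\<Sum>i<k. B i \<omega> *v (W (\<tau> (Suc i)) \<omega> - W (\<tau> i) \<omega>)) > \<epsilon>}
    \<le> prob {\<omega>\<in>space M. \<exists>i<n. norm (B i \<omega>) > \<delta>} + \<delta>\<^sup>2 * CARD('m) * (\<tau> n - \<tau> 0) / \<epsilon>\<^sup>2"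
proof -
  define D where "D i \<omega> = W (\<tau> (Suc i)) \<omega> - W (\<tau> i) \<omega>" for i \<omega>
  define N where "N k \<omega> = (\<Sum>i<k. B i \<omega> *v D i \<omega>)" for k \<omega>
  define good where "good j \<omega> \<longleftrightarrow> norm (N j \<omega>) \<le> \<epsilon> \<and> norm (B j \<omega>) \<le> \<delta>" for j \<omega>
  define Q where "Q k \<omega> \<longleftrightarrow> (\<forall>j\<le>k. good j \<omega>)" for k \<omega>
  define B' where "B' i \<omega> = (if Q i \<omega> then B i \<omega> else 0)" for i \<omega>
  define Z where "Z k \<omega> = (\<Sum>i<k. B' i \<omega> *v D i \<omega>)" for k \<omega>
  have t: "0 \<le> \<tau> j" for j
    using \<tau> by (meson strict_mono_less_eq le0 order_trans)
  have lt: "\<tau> k < \<tau> (Suc k)" for k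
    using \<tau>(1) by (simp add: strict_mono_less)
  have le: "i \<le> j \<Longrightarrow> \<tau> i \<le> \<tau> j" for i j
    using \<tau>(1) by (simp add: strict_mono_less_eq)
  have N_F: "N k \<in> borel_measurable (F (\<tau> k))" for k
    unfolding N_def D_def by (rule brownian_sum_measurable[OF \<tau> B])
  have good_F: "Measurable.pred (F (\<tau> k)) (good k)" for k
    unfolding good_def using N_F[of k] B[of k] by measurable
  have Q_F: "Measurable.pred (F (\<tau> k)) (Q k)" for k
  proof -
    have "Measurable.pred (F (\<tau> k)) (\<lambda>\<omega>. \<forall>j\<in>{..k}. good j \<omega>)"
    proof (intro pred_intros_finite)
      fix j assume "j \<in> {..k}"
      then show "Measurable.pred (F (\<tau> k)) (good j)"
        by (intro measurable_F_mono[OF t le good_F]) simp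
    qed simp
    also have "(\<lambda>\<omega>. \<forall>j\<in>{..k}. good j \<omega>) = Q k"
      by (auto simp: Q_def fun_eq_iff)
    finally show ?thesis .
  qed
  have B'_F: "B' k \<in> borel_measurable (F (\<tau> k))" for k
    unfolding B'_def using B[of k] Q_F[of k] by (intro measurable_If) (auto simp: pred_def)
  have Z_F: "Z k \<in> borel_measurable (F (\<tau> k))" for k
    unfolding Z_def D_def by (rule brownian_sum_measurable[OF \<tau> B'_F])
  have Z_stop: "Z n \<omega> = N k \<omega>" if "\<And>j. j < k \<Longrightarrow> good j \<omega>" "k \<le> n" "k = n \<or> \<not> good k \<omega>" for k n \<omega>
    using sum_stopped[of k "\<lambda>j. good j \<omega>" n "\<lambda>i. B i \<omega> *v D i \<omega>"] that
    unfolding Z_def N_def B'_def Q_def by (simp add: if_distrib[of "\<lambda>A. A *v _"] cong: if_cong)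
  \<comment> \<open>Under \<open>Q k\<close> nothing has been frozen yet, so \<open>Z k\<close> is
    the full sum \<open>N k\<close>, which \<open>good k\<close> bounds by
    \<open>\<epsilon>\<close>.\<close>
  have Z_bound: "norm (Z k \<omega>) \<le> \<epsilon>" "norm (B k \<omega>) \<le> \<delta>" if "Q k \<omega>" for k \<omega>
    using that Z_stop[of k \<omega> k] unfolding Q_def good_def by auto
  have B'_bound: "norm (B' k \<omega>) \<le> \<delta>" for k \<omega>
    using Z_bound(2)[of k \<omega>] \<delta> by (auto simp: B'_def)
  \<comment> \<open>Coefficient of the cross term in the expanded square, transposed so that the
    increment stands alone. Freezing makes it either zero or at most
    \<open>2 * (\<epsilon> * \<delta>)\<close> in norm.\<close>
  define g where "g k \<omega> = 2 *\<^sub>R (Z k \<omega> v* B' k \<omega>)" for k \<omega>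
  have g_F: "g k \<in> borel_measurable (F (\<tau> k))" for k
    unfolding g_def using Z_F[of k] B'_F[of k] by measurable
  have g_bound: "norm (g k \<omega>) \<le> 2 * (\<epsilon> * \<delta>)" for k \<omega>
  proof (cases "Q k \<omega>")
    case True
    have "norm (Z k \<omega> v* B' k \<omega>) \<le> norm (Z k \<omega>) * norm (B' k \<omega>)"
      by (rule norm_vector_matrix_mult_le)
    also have "\<dots> \<le> \<epsilon> * \<delta>"
      using Z_bound(1)[OF True] B'_bound \<epsilon> by (intro mult_mono) auto
    finally show ?thesis by (simp add: g_def)
  qed (use \<epsilon> \<delta> in \<open>simp add: g_def B'_def\<close>)
  have step: "(norm (Z (Suc k) \<omega>))\<^sup>2 \<le> (norm (Z k \<omega>))\<^sup>2 + g k \<omega> \<bullet> D k \<omega> + \<delta>\<^sup>2 * (norm (D k \<omega>))\<^sup>2" for k \<omega>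
  proof -
    have "norm (B' k \<omega> *v D k \<omega>) \<le> \<delta> * norm (D k \<omega>)"
      using norm_matrix_vector_mult_le[of "B' k \<omega>" "D k \<omega>"] B'_bound[of k \<omega>]
      by (meson mult_right_mono norm_ge_zero order_trans)
    then have "(norm (B' k \<omega> *v D k \<omega>))\<^sup>2 \<le> \<delta>\<^sup>2 * (norm (D k \<omega>))\<^sup>2"
      unfolding power_mult_distrib[symmetric] by (intro power_mono) auto
    moreover have "(norm (Z (Suc k) \<omega>))\<^sup>2 = (norm (Z k \<omega>))\<^sup>2 + 2 * (Z k \<omega> \<bullet> (B' k \<omega> *v D k \<omega>)) + (norm (B' k \<omega> *v D k \<omega>))\<^sup>2"
      by (simp add: Z_def power2_norm_eq_inner inner_add_left inner_add_right inner_commute)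
    ultimately show ?thesis
      by (simp add: g_def dot_lmul_matrix)
  qed
  have ZM: "Z k \<in> borel_measurable M" for k
    by (rule measurable_F_M[OF t Z_F])
  have main: "integrable M (\<lambda>\<omega>. (norm (Z k \<omega>))\<^sup>2) \<and>
      expectation (\<lambda>\<omega>. (norm (Z k \<omega>))\<^sup>2) \<le> \<delta>\<^sup>2 * CARD('m) * (\<tau> k - \<tau> 0)" for k
  proof (induction k)
    case 0
    show ?case by (simp add: Z_def)
  next
    case (Suc k)
    have int: "integrable M (\<lambda>\<omega>. (norm (Z k \<omega>))\<^sup>2 + g k \<omega> \<bullet> D k \<omega> + \<delta>\<^sup>2 * (norm (D k \<omega>))\<^sup>2)"
      unfolding D_def
      by (intro Bochner_Integration.integrable_add integrable_mult_right conjunct1[OF Suc.IH]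
          inner_increment(1)[OF t lt g_F g_bound] norm_increment_moments(1)[OF t lt])
    have int': "integrable M (\<lambda>\<omega>. (norm (Z (Suc k) \<omega>))\<^sup>2)"
    proof (rule Bochner_Integration.integrable_bound[OF int])
      show "AE \<omega> in M. norm ((norm (Z (Suc k) \<omega>))\<^sup>2) \<le>
          norm ((norm (Z k \<omega>))\<^sup>2 + g k \<omega> \<bullet> D k \<omega> + \<delta>\<^sup>2 * (norm (D k \<omega>))\<^sup>2)"
        using order_trans[OF step abs_ge_self] by (intro AE_I2) simp
      show "(\<lambda>\<omega>. (norm (Z (Suc k) \<omega>))\<^sup>2) \<in> borel_measurable M"
        by (rule measurable_compose[OF ZM]) measurable
    qed
    have "expectation (\<lambda>\<omega>. (norm (Z (Suc k) \<omega>))\<^sup>2) \<le> expectation (\<lambda>\<omega>. (norm (Z k \<omega>))\<^sup>2) +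
        expectation (\<lambda>_. \<delta>\<^sup>2) * (CARD('m) * (\<tau> (Suc k) - \<tau> k)) +
        0 * (3 * (real CARD('m))\<^sup>2 * (\<tau> (Suc k) - \<tau> k)\<^sup>2) + 0"
      by (rule expectation_step_le[OF t lt g_F g_bound _ _ conjunct1[OF Suc.IH] int'])
        (use step[of k] in \<open>simp_all add: D_def\<close>)
    with conjunct2[OF Suc.IH] have "expectation (\<lambda>\<omega>. (norm (Z (Suc k) \<omega>))\<^sup>2) \<le>
        \<delta>\<^sup>2 * CARD('m) * (\<tau> k - \<tau> 0) + \<delta>\<^sup>2 * (CARD('m) * (\<tau> (Suc k) - \<tau> k))"
      by (simp add: prob_space)
    also have "\<dots> = \<delta>\<^sup>2 * CARD('m) * (\<tau> (Suc k) - \<tau> 0)"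
      by (simp add: algebra_simps)
    finally show ?case using int' by blast
  qed
  let ?E = "{\<omega>\<in>space M. \<exists>i<n. norm (B i \<omega>) > \<delta>}" and ?Z = "{\<omega>\<in>space M. (norm (Z n \<omega>))\<^sup>2 \<ge> \<epsilon>\<^sup>2}"
  note [measurable] = measurable_F_M[OF t B] ZM
  have EM: "?E \<in> events" by measurable
  have ZM': "?Z \<in> events" by measurable
  have "{\<omega>\<in>space M. \<exists>k\<le>n. norm (N k \<omega>) > \<epsilon>} \<subseteq> ?E \<union> ?Z"
  proof safe
    fix \<omega> k
    assume \<omega>: "\<omega> \<in> space M" "k \<le> n" "norm (N k \<omega>) > \<epsilon>" and nz: "\<not> \<epsilon>\<^sup>2 \<le> (norm (Z n \<omega>))\<^sup>2"
    show "\<exists>i<n. norm (B i \<omega>) > \<delta>"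
    proof (rule ccontr)
      assume "\<not> ?thesis"
      then have small: "i < n \<Longrightarrow> norm (B i \<omega>) \<le> \<delta>" for i by auto
      \<comment> \<open>At the first excess \<open>l\<close> the sum freezes, since \<open>N\<close>
        and \<open>B\<close> are small before it. Bounds on \<open>B i\<close> for
        \<open>i < n\<close> suffice because \<open>l \<le> n\<close> and only indices below
        \<open>l\<close> have to be good.\<close>
      define l where "l = (LEAST k. norm (N k \<omega>) > \<epsilon>)"
      have l: "norm (N l \<omega>) > \<epsilon>" "l \<le> k"
        unfolding l_def using \<omega>(3) by (auto intro: LeastI Least_le)
      have "norm (N j \<omega>) \<le> \<epsilon>" if "j < l" for j
        using not_less_Least[of j "\<lambda>k. norm (N k \<omega>) > \<epsilon>"] that by (auto simp: l_def)
      then have "Z n \<omega> = N l \<omega>"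
        using l \<omega>(2) small by (intro Z_stop) (auto simp: good_def)
      with l(1) nz \<epsilon> show False by (simp add: power_mono)
    qed
  qed
  then have "prob {\<omega>\<in>space M. \<exists>k\<le>n. norm (N k \<omega>) > \<epsilon>} \<le> prob (?E \<union> ?Z)"
    using EM ZM' by (intro finite_measure_mono) auto
  also have "\<dots> \<le> prob ?E + prob ?Z"
    by (rule measure_Un_le[OF EM ZM'])
  also have "prob ?Z \<le> expectation (\<lambda>\<omega>. (norm (Z n \<omega>))\<^sup>2) / \<epsilon>\<^sup>2"
    by (rule integral_Markov_inequality_measure[where A = "{}", OF conjunct1[OF main]]) (use \<epsilon> in simp_all)
  also have "\<dots> \<le> \<delta>\<^sup>2 * CARD('m) * (\<tau> n - \<tau> 0) / \<epsilon>\<^sup>2"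
    by (intro divide_right_mono conjunct2[OF main]) simp
  finally show ?thesis
    unfolding N_def D_def by simp
qed

end

text \<open>By uniform continuity each cell contributes at most \<open>e / (T + 1)\<close> times its
  length, so the error is small at all grid points at once. The denominator \<open>T + 1\<close>
  also covers \<open>T = 0\<close>.\<close>

lemma riemann_sum_uniform:
  fixes f :: "real \<Rightarrow> 'a::euclidean_space"
  assumes f: "continuous_on {0..T} f" and T: "0 \<le> T" and e: "0 < e"
  shows "\<forall>\<^sub>F n in sequentially. \<forall>k\<le>n.
    norm ((\<Sum>j<k. (T / n) *\<^sub>R f (T * real j / n)) - integral {0..T * real k / n} f) \<le> e"
proof -
  have "uniformly_continuous_on {0..T} f"
    by (rule compact_uniformly_continuous[OF f compact_Icc])
  then obtain d where d: "d > 0"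
    "\<And>s t. s \<in> {0..T} \<Longrightarrow> t \<in> {0..T} \<Longrightarrow> dist t s < d \<Longrightarrow> dist (f t) (f s) < e / (T + 1)"
    unfolding uniformly_continuous_on_def using e T by (metis add_nonneg_pos divide_pos_pos zero_less_one)
  obtain n0 :: nat where n0: "T / d < n0" using reals_Archimedean2 by blast
  show ?thesis
  proof (rule eventually_sequentiallyI[of "Suc n0"], intro allI impI)
    fix n k :: nat assume n: "Suc n0 \<le> n" and k: "k \<le> n"
    have npos: "0 < real n" using n by simp
    have "T / d < n" using n0 n by linarith
    then have h: "T / n < d" using d(1) npos by (simp add: field_simps)
    have hT: "T * k / n \<le> T" if "k \<le> n" for k :: nat
      using that npos T by (simp add: field_simps mult_left_mono)
    have "norm ((\<Sum>j<k. (T / n) *\<^sub>R f (T * j / n)) - integral {0..T * k / n} f) \<le> k * (T / n * (e / (T + 1)))"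
      using k
    proof (induction k)
      case (Suc k)
      let ?a = "T * k / n" and ?b = "T * Suc k / n"
      have ab: "0 \<le> ?a" "?a \<le> ?b" "?b \<le> T" "?b - ?a = T / n"
        using T npos hT[OF Suc.prems] by (auto simp: field_simps)
      have int: "f integrable_on {0..?b}"
        using ab by (intro integrable_continuous_real continuous_on_subset[OF f]) auto
      have int2: "f integrable_on {?a..?b}"
        using ab by (intro integrable_continuous_real continuous_on_subset[OF f]) auto
      have "((\<lambda>t. f ?a) has_integral ((?b - ?a) *\<^sub>R f ?a)) {?a..?b}"
        using has_integral_const_real[of "f ?a" ?a ?b] ab(2) by (simp only: content_real)
      then have "((\<lambda>t. f ?a - f t) has_integral ((?b - ?a) *\<^sub>R f ?a - integral {?a..?b} f)) {?a..?b}"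
        using int2 by (intro has_integral_diff integrable_integral) auto
      then have 1: "norm ((?b - ?a) *\<^sub>R f ?a - integral {?a..?b} f) \<le> e / (T + 1) * (?b - ?a)"
      proof -
        assume *: "((\<lambda>t. f ?a - f t) has_integral ((?b - ?a) *\<^sub>R f ?a - integral {?a..?b} f)) {?a..?b}"
        have "norm (f ?a - f t) \<le> e / (T + 1)" if "t \<in> {?a..?b}" for t
        proof -
          have "?a \<in> {0..T}" "t \<in> {0..T}" using that ab by auto
          moreover have "dist ?a t < d" using that ab(4) h by (simp add: dist_real_def)
          ultimately have "dist (f ?a) (f t) < e / (T + 1)" by (intro d(2))
          then show ?thesis by (simp add: dist_norm)
        qed
        moreover have "0 \<le> e / (T + 1)" using e T by simp
        ultimately have "norm ((?b - ?a) *\<^sub>R f ?a - integral {?a..?b} f) \<le> e / (T + 1) * measure lborel {?a..?b}"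
          by (intro has_integral_bound_real[OF _ finite.emptyI *]) simp_all
        then show ?thesis by (simp only: content_real[OF ab(2)])
      qed
      have 2: "integral {0..?b} f = integral {0..?a} f + integral {?a..?b} f"
        using ab int by (simp add: Henstock_Kurzweil_Integration.integral_combine)
      show ?case
      proof -
        have eq: "(\<Sum>j<Suc k. (T / n) *\<^sub>R f (T * j / n)) - integral {0..?b} f =
            ((\<Sum>j<k. (T / n) *\<^sub>R f (T * j / n)) - integral {0..?a} f) +
            ((?b - ?a) *\<^sub>R f ?a - integral {?a..?b} f)"
          by (simp only: 2 ab(4) sum.lessThan_Suc) simp
        have "norm ((\<Sum>j<Suc k. (T / n) *\<^sub>R f (T * j / n)) - integral {0..?b} f) \<le>
            k * (T / n * (e / (T + 1))) + e / (T + 1) * (?b - ?a)"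
          unfolding eq using Suc.prems by (intro norm_triangle_mono[OF Suc.IH 1]) simp
        also have "\<dots> = Suc k * (T / n * (e / (T + 1)))"
        proof -
          have "e / (T + 1) * (?b - ?a) = T / n * (e / (T + 1))"
            by (simp only: ab(4) mult.commute)
          then show ?thesis by (simp only: of_nat_Suc distrib_right mult_1 add.commute)
        qed
        finally show ?thesis .
      qed
    qed (simp add: e)
    also have "\<dots> \<le> n * (T / n * (e / (T + 1)))"
      using k T e by (intro mult_right_mono) auto
    also have "\<dots> = e * (T / (T + 1))" using npos by simp
    also have "\<dots> \<le> e * 1" using e T by (intro mult_left_mono) auto
    finally show "norm ((\<Sum>j<k. (T / n) *\<^sub>R f (T * j / n)) - integral {0..T * k / n} f) \<le> e" by simp
  qed
qed

text \<open>The integral is the pathwise limit of measurable Riemann sums, because the paths are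
  continuous.\<close>

lemma integral_continuous_process_measurable:
  fixes \<beta> :: "real \<Rightarrow> 'w \<Rightarrow> 'a::euclidean_space"
  assumes t: "0 \<le> t" and meas: "\<And>s. 0 \<le> s \<Longrightarrow> \<beta> s \<in> borel_measurable M"
    and cont: "\<And>\<omega>. \<omega> \<in> space M \<Longrightarrow> continuous_on {0..t} (\<lambda>s. \<beta> s \<omega>)"
  shows "(\<lambda>\<omega>. integral {0..t} (\<lambda>s. \<beta> s \<omega>)) \<in> borel_measurable M"
proof (rule borel_measurable_LIMSEQ_metric)
  fix n :: nat
  have "\<beta> (t * real j / n) \<in> borel_measurable M" for j
    using t by (intro meas) auto
  then show "(\<lambda>\<omega>. \<Sum>j<n. (t / n) *\<^sub>R \<beta> (t * real j / n) \<omega>) \<in> borel_measurable M"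
    by (intro borel_measurable_sum borel_measurable_scaleR borel_measurable_const)
next
  fix \<omega> assume \<omega>: "\<omega> \<in> space M"
  show "(\<lambda>n. \<Sum>j<n. (t / n) *\<^sub>R \<beta> (t * real j / n) \<omega>) \<longlonglongrightarrow> integral {0..t} (\<lambda>s. \<beta> s \<omega>)"
  proof (rule tendstoI)
    fix e :: real assume e: "0 < e"
    from riemann_sum_uniform[OF cont[OF \<omega>] t, of "e / 2"] e
    have "\<forall>\<^sub>F n in sequentially. \<forall>k\<le>n. norm ((\<Sum>j<k. (t / n) *\<^sub>R \<beta> (t * real j / n) \<omega>) -
        integral {0..t * real k / n} (\<lambda>s. \<beta> s \<omega>)) \<le> e / 2"
      by simp
    then show "\<forall>\<^sub>F n in sequentially. dist (\<Sum>j<n. (t / n) *\<^sub>R \<beta> (t * real j / n) \<omega>)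
        (integral {0..t} (\<lambda>s. \<beta> s \<omega>)) < e"
      using eventually_gt_at_top[of "0::nat"]
    proof eventually_elim
      case (elim n)
      then have "norm ((\<Sum>j<n. (t / n) *\<^sub>R \<beta> (t * real j / n) \<omega>) - integral {0..t * real n / n} (\<lambda>s. \<beta> s \<omega>)) \<le> e / 2"
        by blast
      then show ?case using elim(2) e by (simp add: dist_norm)
    qed
  qed
qed

text \<open>Dominated convergence for the indicators; it turns statements that hold eventually on
  each path into statements about probabilities.\<close>

lemma (in prob_space) prob_tendsto_0:
  assumes E: "\<And>n. E n \<in> events" and ev: "\<And>\<omega>. \<omega> \<in> space M \<Longrightarrow> \<forall>\<^sub>F n in sequentially. \<omega> \<notin> E n"
  shows "(\<lambda>n. prob (E n)) \<longlonglongrightarrow> 0"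
proof -
  have "(\<lambda>n. expectation (indicator (E n) :: _ \<Rightarrow> real)) \<longlonglongrightarrow> expectation (\<lambda>_. 0)"
  proof (rule integral_dominated_convergence[where w = "\<lambda>_. 1"])
    show "AE \<omega> in M. (\<lambda>n. indicator (E n) \<omega> :: real) \<longlonglongrightarrow> 0"
      by (intro AE_I2 tendsto_eventually eventually_mono[OF ev]) auto
  qed (use E in \<open>auto simp: indicator_def\<close>)
  then show ?thesis using E by simp
qed

section \<open>Euler sums of an Ito process\<close>

text \<open>Abstract form of the difference of two solutions. The stochastic integral is no separate
  datum: it is what remains of \<open>\<eta>\<close> without initial value and drift, and so
  inherits measurability.\<close>

locale ito_process = filtered_brownian_motion M F W
  for M :: "'w measure" and F and W :: "real \<Rightarrow> 'w \<Rightarrow> real ^ 'm" +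
  fixes T :: real and A :: "real \<Rightarrow> 'w \<Rightarrow> real ^ 'm ^ 'd"
    and \<beta> \<eta> :: "real \<Rightarrow> 'w \<Rightarrow> real ^ 'd" and z :: "real ^ 'd"
  assumes T_pos: "0 < T"
    and A_adapted: "\<And>t. 0 \<le> t \<Longrightarrow> A t \<in> borel_measurable (F t)"
    and A_cont: "\<And>\<omega>. \<omega> \<in> space M \<Longrightarrow> continuous_on {0..} (\<lambda>t. A t \<omega>)"
    and \<beta>_adapted: "\<And>t. 0 \<le> t \<Longrightarrow> \<beta> t \<in> borel_measurable (F t)"
    and \<beta>_cont: "\<And>\<omega>. \<omega> \<in> space M \<Longrightarrow> continuous_on {0..} (\<lambda>t. \<beta> t \<omega>)"
    and \<eta>_adapted: "\<And>t. 0 \<le> t \<Longrightarrow> \<eta> t \<in> borel_measurable (F t)"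
    and \<eta>_cont: "\<And>\<omega>. \<omega> \<in> space M \<Longrightarrow> continuous_on {0..} (\<lambda>t. \<eta> t \<omega>)"
    and \<eta>_conv: "\<And>t. 0 \<le> t \<Longrightarrow> conv_in_prob M
      (\<lambda>n \<omega>. \<Sum>k<n. A (t * real k / real n) \<omega> *v
        (W (t * real (Suc k) / real n) \<omega> - W (t * real k / real n) \<omega>))
      (\<lambda>\<omega>. \<eta> t \<omega> - z - integral {0..t} (\<lambda>s. \<beta> s \<omega>))"
begin

section \<open>Uniform grids and the sums on them\<close>

definition grid :: "nat \<Rightarrow> nat \<Rightarrow> real" where "grid n k = T * real k / real n"

definition J :: "real \<Rightarrow> 'w \<Rightarrow> real ^ 'd" where
  "J t \<omega> = \<eta> t \<omega> - z - integral {0..t} (\<lambda>s. \<beta> s \<omega>)"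

definition S :: "nat \<Rightarrow> nat \<Rightarrow> 'w \<Rightarrow> real ^ 'd" where
  "S n k \<omega> = (\<Sum>i<k. A (grid n i) \<omega> *v (W (grid n (Suc i)) \<omega> - W (grid n i) \<omega>))"

definition R :: "nat \<Rightarrow> nat \<Rightarrow> 'w \<Rightarrow> real ^ 'd" where
  "R n k \<omega> = (\<Sum>i<k. (T / n) *\<^sub>R \<beta> (grid n i) \<omega>)"

definition euler :: "nat \<Rightarrow> nat \<Rightarrow> 'w \<Rightarrow> real ^ 'd" where
  "euler n k \<omega> = z + R n k \<omega> + S n k \<omega>"

lemma grid_nonneg: "0 \<le> grid n k"
  using T_pos by (simp add: grid_def)

lemma grid_0: "grid n 0 = 0"
  by (simp add: grid_def)

lemma grid_strict_mono: "0 < n \<Longrightarrow> strict_mono (grid n)"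
  using T_pos by (auto simp: strict_mono_def grid_def divide_strict_right_mono)

lemma grid_mono: "i \<le> j \<Longrightarrow> grid n i \<le> grid n j"
  using T_pos by (simp add: grid_def divide_right_mono)

lemma grid_n: "0 < n \<Longrightarrow> grid n n = T"
  by (simp add: grid_def)

lemma grid_le_T: "0 < n \<Longrightarrow> k \<le> n \<Longrightarrow> grid n k \<le> T"
  using grid_mono[of k n n] grid_n by simp

lemma grid_Suc_diff: "grid n (Suc k) - grid n k = T / n"
  by (simp add: grid_def distrib_left add_divide_distrib)

lemma grid_refine: "0 < l \<Longrightarrow> grid (n * l) (k * l) = grid n k"
  by (simp add: grid_def)

lemma integral_\<beta>_measurable:
  assumes t: "0 \<le> t"
  shows "(\<lambda>\<omega>. integral {0..t} (\<lambda>s. \<beta> s \<omega>)) \<in> borel_measurable M"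
  by (rule integral_continuous_process_measurable[OF t measurable_F_M[OF _ \<beta>_adapted]])
    (auto intro: continuous_on_subset[OF \<beta>_cont])

lemma A_grid_F: "A (grid n k) \<in> borel_measurable (F (grid n k))"
  by (rule A_adapted[OF grid_nonneg])

lemma A_measurable: "0 \<le> t \<Longrightarrow> A t \<in> borel_measurable M"
  by (rule measurable_F_M[OF _ A_adapted])

lemma \<eta>_measurable: "0 \<le> t \<Longrightarrow> \<eta> t \<in> borel_measurable M"
  by (rule measurable_F_M[OF _ \<eta>_adapted])

lemma S_F: "0 < n \<Longrightarrow> S n k \<in> borel_measurable (F (grid n k))"
  unfolding S_def
  by (rule brownian_sum_measurable[OF grid_strict_mono _ A_grid_F]) (auto simp: grid_0)

lemma S_measurable: "0 < n \<Longrightarrow> S n k \<in> borel_measurable M"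
  by (rule measurable_F_M[OF grid_nonneg S_F])

lemma R_F: "R n k \<in> borel_measurable (F (grid n k))"
proof -
  have "\<beta> (grid n i) \<in> borel_measurable (F (grid n k))" if "i < k" for i
    using that by (intro measurable_F_mono[OF _ _ \<beta>_adapted] grid_nonneg grid_mono) auto
  then have "(\<lambda>\<omega>. \<Sum>i<k. (T / n) *\<^sub>R \<beta> (grid n i) \<omega>) \<in> borel_measurable (F (grid n k))"
    by (intro borel_measurable_sum borel_measurable_scaleR borel_measurable_const) auto
  then show ?thesis by (simp add: R_def[abs_def])
qed

lemma euler_F: "0 < n \<Longrightarrow> euler n k \<in> borel_measurable (F (grid n k))"
  unfolding euler_def[abs_def]
  by (intro borel_measurable_add borel_measurable_const R_F S_F)

lemma J_measurable: "0 \<le> t \<Longrightarrow> J t \<in> borel_measurable M"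
  unfolding J_def[abs_def]
  by (intro borel_measurable_diff borel_measurable_const \<eta>_measurable integral_\<beta>_measurable)

text \<open>The convergence assumed at time \<open>grid n k\<close> uses \<open>j\<close> equal
  cells. Along \<open>j = k * l\<close> they have length \<open>T / (n * l)\<close>, so the sums are
  partial sums on the refined grid. For \<open>k = 0\<close> this is no subsequence, and the claim
  is the convergence at time \<open>0\<close>.\<close>

lemma S_refine_conv:
  assumes n: "0 < n" and e: "0 < e"
  shows "(\<lambda>l. prob {\<omega>\<in>space M. norm (S (n * l) (k * l) \<omega> - J (grid n k) \<omega>) > e}) \<longlonglongrightarrow> 0"
proof (cases "k = 0")
  case True
  have "(\<lambda>n. prob {\<omega> \<in> space M. norm (0 - J 0 \<omega>) > e}) \<longlonglongrightarrow> 0"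
    using \<eta>_conv[of 0] e by (simp add: conv_in_prob_def J_def)
  then show ?thesis using True by (simp add: S_def grid_0)
next
  case False
  have eq: "(\<Sum>i<k * l. A (grid n k * real i / real (k * l)) \<omega> *v
        (W (grid n k * real (Suc i) / real (k * l)) \<omega> - W (grid n k * real i / real (k * l)) \<omega>))
      = S (n * l) (k * l) \<omega>" for l \<omega>
  proof -
    have "grid n k * real i / real (k * l) = grid (n * l) i" for i
      using False by (simp add: grid_def)
    then show ?thesis by (simp only: S_def)
  qed
  have lim: "(\<lambda>j. prob {\<omega>\<in>space M. norm ((\<Sum>i<j. A (grid n k * real i / real j) \<omega> *v
        (W (grid n k * real (Suc i) / real j) \<omega> - W (grid n k * real i / real j) \<omega>))
        - J (grid n k) \<omega>) > e}) \<longlonglongrightarrow> 0"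
    using \<eta>_conv[OF grid_nonneg[of n k]] e unfolding conv_in_prob_def J_def by blast
  have "strict_mono (\<lambda>l. k * l)" using False by (simp add: strict_mono_def)
  from LIMSEQ_subseq_LIMSEQ[OF lim this] show ?thesis
    by (simp only: comp_def eq)
qed

text \<open>\<open>i div l\<close> is the coarse cell that contains the fine index \<open>i\<close>.
  Variation of the coefficient within a cell is seen only through fine grid points, which keeps the
  event measurable.\<close>

definition modulus_event :: "nat \<Rightarrow> nat \<Rightarrow> real \<Rightarrow> 'w set" where
  "modulus_event n l \<delta> =
    {\<omega>\<in>space M. \<exists>i<n * l. norm (A (grid n (i div l)) \<omega> - A (grid (n * l) i) \<omega>) > \<delta>}"

lemma modulus_event_measurable: "modulus_event n l \<delta> \<in> events"
proof -
  note [measurable] = A_measurable[OF grid_nonneg]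
  show ?thesis unfolding modulus_event_def by measurable
qed

text \<open>Written on the fine grid, the difference is a single sum against increments, with
  coefficient \<open>A\<close> at the coarse time minus \<open>A\<close> at the fine time, so the
  maximal inequality applies. The bound depends on \<open>l\<close> only through the modulus
  event.\<close>

lemma S_refine_le:
  assumes n: "0 < n" and l: "0 < l" and \<delta>: "0 \<le> \<delta>" and e: "0 < e"
  shows "prob {\<omega>\<in>space M. \<exists>k\<le>n. norm (S n k \<omega> - S (n * l) (k * l) \<omega>) > e}
    \<le> prob (modulus_event n l \<delta>) + \<delta>\<^sup>2 * CARD('m) * T / e\<^sup>2"
proof -
  have nl: "0 < n * l" using n l by simp
  define B where "B i \<omega> = A (grid n (i div l)) \<omega> - A (grid (n * l) i) \<omega>" for i \<omega>
  define D where "D i \<omega> = W (grid (n * l) (Suc i)) \<omega> - W (grid (n * l) i) \<omega>" for i \<omega>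
  \<comment> \<open>The coarse time never exceeds the fine one, which makes the difference of the
    coefficients adapted.\<close>
  have le: "grid n (i div l) \<le> grid (n * l) i" for i
    using grid_mono[of "i div l * l" i "n * l"] grid_refine[OF l] by simp
  have "A (grid n (i div l)) \<in> borel_measurable (F (grid (n * l) i))" for i
    by (rule measurable_F_mono[OF grid_nonneg le A_grid_F])
  then have B: "B i \<in> borel_measurable (F (grid (n * l) i))" for i
    unfolding B_def by (intro borel_measurable_diff A_grid_F)
  have eq: "S n k \<omega> - S (n * l) (k * l) \<omega> = (\<Sum>i<k * l. B i \<omega> *v D i \<omega>)" for k \<omega>
  proof -
    \<comment> \<open>Within a coarse cell the coefficient is constant and the fine increments
      telescope.\<close>
    have "(\<Sum>i\<in>{j * l..<j * l + l}. A (grid n (i div l)) \<omega> *v D i \<omega>) =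
        A (grid n j) \<omega> *v (W (grid n (Suc j)) \<omega> - W (grid n j) \<omega>)" for j
    proof -
      have "(\<Sum>i\<in>{j * l..<j * l + l}. A (grid n (i div l)) \<omega> *v D i \<omega>) =
          (\<Sum>i\<in>{j * l..<j * l + l}. A (grid n j) \<omega> *v D i \<omega>)"
      proof (rule sum.cong[OF refl])
        fix i assume "i \<in> {j * l..<j * l + l}"
        then have "i div l = j" using l by (intro div_nat_eqI) (auto simp: mult.commute)
        then show "A (grid n (i div l)) \<omega> *v D i \<omega> = A (grid n j) \<omega> *v D i \<omega>" by simp
      qed
      also have "\<dots> = A (grid n j) \<omega> *v (\<Sum>i\<in>{j * l..<j * l + l}. D i \<omega>)"
        by (simp add: bounded_bilinear.sum_right[OF bounded_bilinear_matrix_vector_mult])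
      also have "(\<Sum>i\<in>{j * l..<j * l + l}. D i \<omega>) = W (grid (n * l) (j * l + l)) \<omega> - W (grid (n * l) (j * l)) \<omega>"
        unfolding D_def by (rule sum_Suc_diff') simp
      also have "\<dots> = W (grid n (Suc j)) \<omega> - W (grid n j) \<omega>"
        using grid_refine[OF l, of n j] grid_refine[OF l, of n "Suc j"] by (simp add: add.commute)
      finally show ?thesis .
    qed
    then have "S n k \<omega> = (\<Sum>i<k * l. A (grid n (i div l)) \<omega> *v D i \<omega>)"
      unfolding S_def sum.nat_group[symmetric] by simp
    then show ?thesis
      by (simp add: S_def B_def D_def[symmetric] sum_subtractf matrix_vector_mult_diff_rdistrib)
  qed
  have "prob {\<omega>\<in>space M. \<exists>k\<le>n. norm (S n k \<omega> - S (n * l) (k * l) \<omega>) > e} \<le>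
      prob {\<omega>\<in>space M. \<exists>k\<le>n * l. norm (\<Sum>i<k. B i \<omega> *v D i \<omega>) > e}"
  proof (rule finite_measure_mono)
    show "{\<omega>\<in>space M. \<exists>k\<le>n. norm (S n k \<omega> - S (n * l) (k * l) \<omega>) > e} \<subseteq>
        {\<omega>\<in>space M. \<exists>k\<le>n * l. norm (\<Sum>i<k. B i \<omega> *v D i \<omega>) > e}"
      unfolding eq by (auto intro: mult_le_mono1)
    have "(\<lambda>\<omega>. \<Sum>i<k. B i \<omega> *v D i \<omega>) \<in> borel_measurable M" for k
      unfolding D_def
      by (rule measurable_F_M[OF grid_nonneg brownian_sum_measurable[OF grid_strict_mono[OF nl] _ B]])
        (simp add: grid_0)
    note [measurable] = this
    show "{\<omega>\<in>space M. \<exists>k\<le>n * l. norm (\<Sum>i<k. B i \<omega> *v D i \<omega>) > e} \<in> events"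
      by measurable
  qed
  also have "\<dots> \<le> prob {\<omega>\<in>space M. \<exists>i<n * l. norm (B i \<omega>) > \<delta>} +
      \<delta>\<^sup>2 * CARD('m) * (grid (n * l) (n * l) - grid (n * l) 0) / e\<^sup>2"
    unfolding D_def
    by (rule brownian_sum_maximal_inequality[OF grid_strict_mono[OF nl] _ B \<delta> e]) (simp add: grid_0)
  finally show ?thesis
    by (simp only: grid_n[OF nl] grid_0 modulus_event_def B_def diff_0_right)
qed

text \<open>The threshold for \<open>n\<close> from uniform continuity of a path serves every
  refinement \<open>l\<close>, hence the union. This uniformity allows \<open>l\<close> to tend to
  infinity before \<open>n\<close> does.\<close>

lemma modulus_tendsto_0:
  assumes \<delta>: "0 < \<delta>"
  shows "(\<lambda>n. prob (\<Union>l. modulus_event n l \<delta>)) \<longlonglongrightarrow> 0"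
proof (rule prob_tendsto_0)
  show "(\<Union>l. modulus_event n l \<delta>) \<in> events" for n
    using modulus_event_measurable by blast
next
  fix \<omega> assume \<omega>: "\<omega> \<in> space M"
  have "uniformly_continuous_on {0..T} (\<lambda>t. A t \<omega>)"
    by (intro compact_uniformly_continuous[OF _ compact_Icc] continuous_on_subset[OF A_cont[OF \<omega>]]) auto
  then obtain d where d: "d > 0"
    "\<And>s t. s \<in> {0..T} \<Longrightarrow> t \<in> {0..T} \<Longrightarrow> dist t s < d \<Longrightarrow> dist (A t \<omega>) (A s \<omega>) < \<delta>"
    unfolding uniformly_continuous_on_def using \<delta> by meson
  obtain n0 :: nat where n0: "T / d < n0" using reals_Archimedean2 by blast
  show "\<forall>\<^sub>F n in sequentially. \<omega> \<notin> (\<Union>l. modulus_event n l \<delta>)"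
  proof (rule eventually_sequentiallyI[of "Suc n0"], rule notI)
    fix n assume n: "Suc n0 \<le> n" and "\<omega> \<in> (\<Union>l. modulus_event n l \<delta>)"
    then obtain l i where i: "i < n * l" and gt: "norm (A (grid n (i div l)) \<omega> - A (grid (n * l) i) \<omega>) > \<delta>"
      by (auto simp: modulus_event_def)
    have l: "0 < l" and npos: "0 < n" using i by (auto intro: gr0I)
    have "T / d < n" using n0 n by linarith
    then have h: "T / n < d" using d(1) npos by (simp add: field_simps)
    \<comment> \<open>The fine time lies in the coarse cell that starts at
      \<open>grid n (i div l)\<close>, so the two times differ by at most
      \<open>T / n < d\<close>.\<close>
    have 1: "grid n (i div l) \<le> grid (n * l) i"
      using grid_mono[of "i div l * l" i "n * l"] grid_refine[OF l] by simp
    have "i \<le> Suc (i div l) * l"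
      using l by (metis dividend_less_div_times less_imp_le mult_Suc add.commute)
    then have 2: "grid (n * l) i \<le> grid n (Suc (i div l))"
      using grid_mono[of i "Suc (i div l) * l" "n * l"] grid_refine[OF l, of n "Suc (i div l)"] by simp
    have 3: "grid (n * l) i \<le> T"
      using i l npos by (intro grid_le_T) auto
    have "dist (grid n (i div l)) (grid (n * l) i) < d"
      using 1 2 h grid_Suc_diff[of n "i div l"] by (simp add: dist_real_def)
    then have "dist (A (grid n (i div l)) \<omega>) (A (grid (n * l) i) \<omega>) < \<delta>"
      using 1 3 grid_nonneg[of n "i div l"] grid_nonneg[of "n * l" i] by (intro d(2)) auto
    with gt show False by (simp add: dist_norm)
  qed
qed

lemma S_J_event: "0 < n \<Longrightarrow> {\<omega>\<in>space M. \<exists>k\<le>n. norm (S n k \<omega> - J (grid n k) \<omega>) > e} \<in> events"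
proof -
  assume n: "0 < n"
  note [measurable] = S_measurable[OF n] J_measurable[OF grid_nonneg]
  show ?thesis by measurable
qed

text \<open>Let \<open>l\<close> tend to infinity with \<open>n\<close> fixed. The coarse-to-fine
  error has a bound free of \<open>l\<close>, and the fine sums converge to \<open>J\<close> at the
  finitely many points \<open>grid n k\<close>. Convergence at fixed times thereby becomes uniform
  over the grid.\<close>

lemma S_J_le:
  assumes n: "0 < n" and \<delta>: "0 \<le> \<delta>" and e: "0 < e"
  shows "prob {\<omega>\<in>space M. \<exists>k\<le>n. norm (S n k \<omega> - J (grid n k) \<omega>) > e}
    \<le> prob (\<Union>l. modulus_event n l \<delta>) + \<delta>\<^sup>2 * CARD('m) * T / (e / 2)\<^sup>2"
proof -
  let ?P = "\<lambda>k l. {\<omega>\<in>space M. norm (S (n * l) (k * l) \<omega> - J (grid n k) \<omega>) > e / 2}"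
  have "(\<lambda>l. (\<Sum>k\<le>n. prob (?P k l))) \<longlonglongrightarrow> (\<Sum>k\<le>n. 0)"
    using e by (intro tendsto_sum S_refine_conv[OF n]) auto
  then have lim: "(\<lambda>l. prob (\<Union>l. modulus_event n l \<delta>) + \<delta>\<^sup>2 * CARD('m) * T / (e / 2)\<^sup>2 + (\<Sum>k\<le>n. prob (?P k l)))
      \<longlonglongrightarrow> prob (\<Union>l. modulus_event n l \<delta>) + \<delta>\<^sup>2 * CARD('m) * T / (e / 2)\<^sup>2 + 0"
    by (intro tendsto_add tendsto_const) simp
  have bound: "prob {\<omega>\<in>space M. \<exists>k\<le>n. norm (S n k \<omega> - J (grid n k) \<omega>) > e} \<le>
      prob (\<Union>l. modulus_event n l \<delta>) + \<delta>\<^sup>2 * CARD('m) * T / (e / 2)\<^sup>2 + (\<Sum>k\<le>n. prob (?P k l))"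
    if l: "1 \<le> l" for l
  proof -
    have l': "0 < l" "0 < n * l" using l n by auto
    let ?Q = "{\<omega>\<in>space M. \<exists>k\<le>n. norm (S n k \<omega> - S (n * l) (k * l) \<omega>) > e / 2}"
    note [measurable] = S_measurable[OF n] S_measurable[OF l'(2)] J_measurable[OF grid_nonneg]
    have Q: "?Q \<in> events" by measurable
    have P: "?P k l \<in> events" for k by measurable
    have PU: "(\<Union>k\<le>n. ?P k l) \<in> events" using P by blast
    have "{\<omega>\<in>space M. \<exists>k\<le>n. norm (S n k \<omega> - J (grid n k) \<omega>) > e} \<subseteq> ?Q \<union> (\<Union>k\<le>n. ?P k l)"
    proof safe
      fix \<omega> k assume *: "\<omega> \<in> space M" "k \<le> n" "norm (S n k \<omega> - J (grid n k) \<omega>) > e"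
        and "\<omega> \<notin> (\<Union>k\<le>n. ?P k l)"
      then have "norm (S (n * l) (k * l) \<omega> - J (grid n k) \<omega>) \<le> e / 2" by force
      then have "norm (S n k \<omega> - S (n * l) (k * l) \<omega>) > e / 2"
        using *(3) norm_triangle_ineq[of "S n k \<omega> - S (n * l) (k * l) \<omega>" "S (n * l) (k * l) \<omega> - J (grid n k) \<omega>"]
        by simp
      then show "\<exists>k\<le>n. norm (S n k \<omega> - S (n * l) (k * l) \<omega>) > e / 2" using *(2) by blast
    qed
    then have "prob {\<omega>\<in>space M. \<exists>k\<le>n. norm (S n k \<omega> - J (grid n k) \<omega>) > e} \<le> prob (?Q \<union> (\<Union>k\<le>n. ?P k l))"
      using Q PU by (intro finite_measure_mono) auto
    also have "\<dots> \<le> prob ?Q + prob (\<Union>k\<le>n. ?P k l)"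
      by (rule measure_Un_le[OF Q PU])
    also have "prob (\<Union>k\<le>n. ?P k l) \<le> (\<Sum>k\<le>n. prob (?P k l))"
      using P by (intro finite_measure_subadditive_finite) auto
    also have "prob ?Q \<le> prob (modulus_event n l \<delta>) + \<delta>\<^sup>2 * CARD('m) * T / (e / 2)\<^sup>2"
      using e by (intro S_refine_le[OF n l'(1) \<delta>]) simp
    also have "prob (modulus_event n l \<delta>) \<le> prob (\<Union>l. modulus_event n l \<delta>)"
      using modulus_event_measurable by (intro finite_measure_mono) blast+
    finally show ?thesis by simp
  qed
  show ?thesis
    using LIMSEQ_le_const[OF lim, of "prob {\<omega>\<in>space M. \<exists>k\<le>n. norm (S n k \<omega> - J (grid n k) \<omega>) > e}"] bound
    by auto
qed

lemma S_J_tendsto_0: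
  assumes e: "0 < e"
  shows "(\<lambda>n. prob {\<omega>\<in>space M. \<exists>k\<le>n. norm (S n k \<omega> - J (grid n k) \<omega>) > e}) \<longlonglongrightarrow> 0"
proof (rule tendstoI)
  fix r :: real assume r: "0 < r"
  define K where "K = real CARD('m) * T / (e / 2)\<^sup>2"
  have K: "0 < K" using T_pos e by (simp add: K_def)
  \<comment> \<open>Makes the variance term of the bound equal to \<open>r / 4\<close>; the modulus
    probability is required to be below \<open>r / 2\<close>.\<close>
  define \<delta> where "\<delta> = sqrt (r / (4 * K))"
  have \<delta>: "0 < \<delta>" "\<delta>\<^sup>2 * K = r / 4" using r K by (auto simp: \<delta>_def)
  have "\<forall>\<^sub>F n in sequentially. prob (\<Union>l. modulus_event n l \<delta>) < r / 2"
    using order_tendstoD(2)[OF modulus_tendsto_0[OF \<delta>(1)], of "r / 2"] r by simp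
  then show "\<forall>\<^sub>F n in sequentially. dist (prob {\<omega>\<in>space M. \<exists>k\<le>n. norm (S n k \<omega> - J (grid n k) \<omega>) > e}) 0 < r"
    using eventually_gt_at_top[of "0::nat"]
  proof eventually_elim
    case (elim n)
    have eq: "\<delta>\<^sup>2 * CARD('m) * T / (e / 2)\<^sup>2 = r / 4"
      unfolding \<delta>(2)[symmetric] K_def by simp
    have "prob {\<omega>\<in>space M. \<exists>k\<le>n. norm (S n k \<omega> - J (grid n k) \<omega>) > e} < r"
      using S_J_le[OF elim(2) less_imp_le[OF \<delta>(1)] e] elim(1) r unfolding eq by linarith
    then show ?case by simp
  qed
qed

section \<open>Uniform convergence of the Euler sums to the process\<close>

definition euler_error :: "nat \<Rightarrow> real \<Rightarrow> 'w set" where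
  "euler_error n e = {\<omega>\<in>space M. \<exists>k\<le>n. norm (euler n k \<omega> - \<eta> (grid n k) \<omega>) > e}"

lemma euler_error_event: "0 < n \<Longrightarrow> euler_error n e \<in> events"
proof -
  assume n: "0 < n"
  note [measurable] = measurable_F_M[OF grid_nonneg euler_F[OF n]] \<eta>_measurable[OF grid_nonneg]
  show ?thesis unfolding euler_error_def by measurable
qed

lemma euler_error_tendsto_0:
  assumes e: "0 < e"
  shows "(\<lambda>n. prob (euler_error n e)) \<longlonglongrightarrow> 0"
proof -
  define I where "I k n \<omega> = R n k \<omega> - integral {0..grid n k} (\<lambda>s. \<beta> s \<omega>)" for k n \<omega>
  define E where "E n = {\<omega>\<in>space M. \<exists>k\<le>n. norm (I k n \<omega>) > e / 2}" for n
  have "I k n \<in> borel_measurable M" for k n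
    unfolding I_def by (intro borel_measurable_diff integral_\<beta>_measurable measurable_F_M[OF grid_nonneg R_F] grid_nonneg)
  note [measurable] = this
  have E_ev: "E n \<in> events" for n unfolding E_def by measurable
  have "(\<lambda>n. prob (E n)) \<longlonglongrightarrow> 0"
  proof (rule prob_tendsto_0[OF E_ev])
    fix \<omega> assume \<omega>: "\<omega> \<in> space M"
    have "continuous_on {0..T} (\<lambda>s. \<beta> s \<omega>)"
      by (rule continuous_on_subset[OF \<beta>_cont[OF \<omega>]]) auto
    from riemann_sum_uniform[OF this, of "e / 2"] e T_pos
    have "\<forall>\<^sub>F n in sequentially. \<forall>k\<le>n. norm (I k n \<omega>) \<le> e / 2"
      by (simp add: I_def R_def grid_def)
    then show "\<forall>\<^sub>F n in sequentially. \<omega> \<notin> E n"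
      by eventually_elim (auto simp: E_def not_less[symmetric])
  qed
  from tendsto_add[OF this S_J_tendsto_0[of "e / 2"]] e
  have lim: "(\<lambda>n. prob (E n) + prob {\<omega>\<in>space M. \<exists>k\<le>n. norm (S n k \<omega> - J (grid n k) \<omega>) > e / 2}) \<longlonglongrightarrow> 0"
    by simp
  have "\<forall>\<^sub>F n in sequentially. prob (euler_error n e) \<le>
      prob (E n) + prob {\<omega>\<in>space M. \<exists>k\<le>n. norm (S n k \<omega> - J (grid n k) \<omega>) > e / 2}"
    using eventually_gt_at_top[of "0::nat"]
  proof eventually_elim
    case (elim n)
    let ?SJ = "{\<omega>\<in>space M. \<exists>k\<le>n. norm (S n k \<omega> - J (grid n k) \<omega>) > e / 2}"
    have "euler_error n e \<subseteq> E n \<union> ?SJ"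
    proof
      fix \<omega> assume "\<omega> \<in> euler_error n e"
      then obtain k where k: "\<omega> \<in> space M" "k \<le> n" "norm (euler n k \<omega> - \<eta> (grid n k) \<omega>) > e"
        by (auto simp: euler_error_def)
      have "euler n k \<omega> - \<eta> (grid n k) \<omega> = I k n \<omega> + (S n k \<omega> - J (grid n k) \<omega>)"
        by (simp add: euler_def I_def J_def)
      then have "norm (I k n \<omega> + (S n k \<omega> - J (grid n k) \<omega>)) > e"
        using k(3) by (simp only:)
      then have "norm (I k n \<omega>) > e / 2 \<or> norm (S n k \<omega> - J (grid n k) \<omega>) > e / 2"
        using norm_triangle_ineq[of "I k n \<omega>" "S n k \<omega> - J (grid n k) \<omega>"] by argo
      then show "\<omega> \<in> E n \<union> ?SJ" using k(1,2) by (auto simp: E_def)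
    qed
    then have "prob (euler_error n e) \<le> prob (E n \<union> ?SJ)"
      by (rule finite_measure_mono[OF _ sets.Un[OF E_ev S_J_event[OF elim]]])
    also have "\<dots> \<le> prob (E n) + prob ?SJ"
      by (rule measure_Un_le[OF E_ev S_J_event[OF elim]])
    finally show ?case .
  qed
  then show ?thesis
    by (intro tendsto_sandwich[OF _ _ tendsto_const lim]) (auto simp: measure_nonneg)
qed

end

section \<open>The logarithmic Lyapunov function\<close>

text \<open>The argument stands for a squared distance. The leading \<open>1\<close> keeps the value
  at least \<open>1\<close>, so that additive constants can be absorbed into multiples of
  \<open>lyap\<close>.\<close>

definition lyap :: "real \<Rightarrow> real" where "lyap \<xi> = 1 + ln (1 + 1 / \<xi>)"

lemma lyap_ge_1: "0 < \<xi> \<Longrightarrow> 1 \<le> lyap \<xi>"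
  by (simp add: lyap_def)

lemma lyap_antimono: "0 < a \<Longrightarrow> a \<le> b \<Longrightarrow> lyap b \<le> lyap a"
  by (simp add: lyap_def frac_le add_pos_nonneg add_pos_pos)

text \<open>The factor \<open>3\<close> bounds \<open>1 + ln 5\<close>. The scale \<open>5\<close>
  is the one lost when a squared distance is compared with its perturbed and regularised
  version.\<close>

lemma lyap_scale_5:
  assumes "0 < \<xi>" shows "lyap (\<xi> / 5) \<le> 3 * lyap \<xi>"
proof -
  have "ln 5 \<le> (2::real)"
    using exp_lower_Taylor_quadratic[of "2::real"] ln_mono[of 5 "exp 2 :: real"] by simp
  moreover have "ln (1 + 5 / \<xi>) \<le> ln (5 * (1 + 1 / \<xi>))"
    using assms by (simp add: add_pos_pos field_simps)
  moreover have "ln (5 * (1 + 1 / \<xi>)) = ln 5 + ln (1 + 1 / \<xi>)"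
    using assms by (intro ln_mult_pos) (auto intro: add_pos_pos)
  moreover have "0 \<le> ln (1 + 1 / \<xi>)" using assms by simp
  ultimately show ?thesis by (simp add: lyap_def)
qed

text \<open>Write \<open>lyap \<xi>\<close> as \<open>1 + ln (1 + \<xi>) - ln \<xi>\<close> and
  apply \<open>ln u \<le> u - 1\<close> to both differences. The first-order parts combine to the
  derivative; the assumption \<open>\<xi> / 2 \<le> \<xi>'\<close> controls the second-order
  remainder of the part \<open>- ln \<xi>\<close>.\<close>

lemma lyap_small_jump:
  assumes \<xi>: "0 < \<xi>" and \<xi>': "\<xi> / 2 \<le> \<xi>'"
  shows "lyap \<xi>' \<le> lyap \<xi> - (\<xi>' - \<xi>) / (\<xi> * (1 + \<xi>)) + 2 * (\<xi>' - \<xi>)\<^sup>2 / \<xi>\<^sup>2"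
proof -
  define q where "q = \<xi>' - \<xi>"
  have \<xi>'_pos: "0 < \<xi>'" using assms by linarith
  have eq: "lyap x = 1 + (ln (1 + x) - ln x)" if "0 < x" for x
  proof -
    have "1 + 1 / x = (1 + x) / x" using that by (simp add: field_simps)
    then show ?thesis using that by (simp add: lyap_def ln_div)
  qed
  have "ln (1 + \<xi>') - ln (1 + \<xi>) = ln ((1 + \<xi>') / (1 + \<xi>))"
    using \<xi> \<xi>'_pos by (simp add: ln_div)
  also have "\<dots> \<le> (1 + \<xi>') / (1 + \<xi>) - 1"
    using \<xi> \<xi>'_pos by (intro ln_le_minus_one) simp
  also have "\<dots> = q / (1 + \<xi>)" using \<xi> by (simp add: q_def field_simps)
  finally have 1: "ln (1 + \<xi>') - ln (1 + \<xi>) \<le> q / (1 + \<xi>)" .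
  have "ln \<xi> - ln \<xi>' = ln (\<xi> / \<xi>')"
    using \<xi> \<xi>'_pos by (simp add: ln_div)
  also have "\<dots> \<le> \<xi> / \<xi>' - 1"
    using \<xi> \<xi>'_pos by (intro ln_le_minus_one) simp
  also have "\<dots> = - (q / \<xi>) + q\<^sup>2 / (\<xi> * \<xi>')"
    using \<xi> \<xi>'_pos by (simp add: q_def field_simps power2_eq_square)
  also have "q\<^sup>2 / (\<xi> * \<xi>') \<le> q\<^sup>2 / (\<xi> * (\<xi> / 2))"
    using \<xi> \<xi>' \<xi>'_pos by (intro divide_left_mono mult_left_mono) auto
  also have "q\<^sup>2 / (\<xi> * (\<xi> / 2)) = 2 * q\<^sup>2 / \<xi>\<^sup>2"
    by (simp add: power2_eq_square)
  finally have 2: "ln \<xi> - ln \<xi>' \<le> - (q / \<xi>) + 2 * q\<^sup>2 / \<xi>\<^sup>2" by simp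
  have 3: "q / (1 + \<xi>) - q / \<xi> = - (q / (\<xi> * (1 + \<xi>)))"
    using \<xi> by (simp add: field_simps)
  show ?thesis
    using 1 2 3 unfolding eq[OF \<xi>] eq[OF \<xi>'_pos] q_def[symmetric] by linarith
qed

text \<open>The last term absorbs the rare event that \<open>\<xi>\<close> is more than halved in one step.\<close>

lemma lyap_step:
  fixes \<eta> h :: "'a::real_inner" and \<epsilon> :: real
  assumes \<epsilon>: "0 < \<epsilon>"
  defines "\<xi> \<equiv> (norm \<eta>)\<^sup>2 + \<epsilon>\<^sup>2"
  shows "lyap ((norm (\<eta> + h))\<^sup>2 + \<epsilon>\<^sup>2) \<le> lyap \<xi> - 2 * (\<eta> \<bullet> h) / (\<xi> * (1 + \<xi>))
    + 16 * (norm h)\<^sup>2 / \<xi> + (4 + 256 * lyap (\<epsilon>\<^sup>2)) / \<epsilon> ^ 4 * norm h ^ 4"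
proof -
  define \<xi>' where "\<xi>' = (norm (\<eta> + h))\<^sup>2 + \<epsilon>\<^sup>2"
  have pos: "0 < \<xi>" "0 < \<xi>'" "0 < \<epsilon>\<^sup>2" "0 < \<epsilon> ^ 4"
    using \<epsilon> by (simp_all add: \<xi>_def \<xi>'_def add_nonneg_pos)
  have ge: "\<epsilon>\<^sup>2 \<le> \<xi>" "\<epsilon>\<^sup>2 \<le> \<xi>'" "(norm \<eta>)\<^sup>2 \<le> \<xi>" by (simp_all add: \<xi>_def \<xi>'_def)
  have "(\<epsilon>\<^sup>2)\<^sup>2 \<le> \<xi>\<^sup>2" by (intro power_mono ge) simp
  then have ge4: "\<epsilon> ^ 4 \<le> \<xi>\<^sup>2" by simp
  have q: "\<xi>' - \<xi> = 2 * (\<eta> \<bullet> h) + (norm h)\<^sup>2"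
    by (simp add: \<xi>_def \<xi>'_def power2_norm_eq_inner inner_add_left inner_add_right inner_commute)
  have l\<epsilon>: "1 \<le> lyap (\<epsilon>\<^sup>2)" "1 \<le> lyap \<xi>" "lyap \<xi>' \<le> lyap (\<epsilon>\<^sup>2)"
    using lyap_ge_1 pos lyap_antimono[OF pos(3) ge(2)] by auto
  have inner: "\<bar>\<eta> \<bullet> h\<bar> \<le> norm \<eta> * norm h" by (rule Cauchy_Schwarz_ineq2)
  show ?thesis
  proof (cases "\<xi> / 2 \<le> \<xi>'")
    case True
    have "(\<xi>' - \<xi>)\<^sup>2 \<le> 2 * (2 * (\<eta> \<bullet> h))\<^sup>2 + 2 * ((norm h)\<^sup>2)\<^sup>2"
      unfolding q using sum_squares_bound[of "2 * (\<eta> \<bullet> h)" "(norm h)\<^sup>2"]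
      by (simp add: power2_sum)
    also have "(2 * (\<eta> \<bullet> h))\<^sup>2 = 4 * \<bar>\<eta> \<bullet> h\<bar>\<^sup>2" by (simp add: power_mult_distrib)
    also have "\<bar>\<eta> \<bullet> h\<bar>\<^sup>2 \<le> (norm \<eta> * norm h)\<^sup>2" by (intro power_mono inner) simp
    also have "(norm \<eta> * norm h)\<^sup>2 \<le> \<xi> * (norm h)\<^sup>2"
      unfolding power_mult_distrib by (intro mult_right_mono ge) simp
    finally have "(\<xi>' - \<xi>)\<^sup>2 \<le> 8 * \<xi> * (norm h)\<^sup>2 + 2 * norm h ^ 4" by simp
    then have "2 * (\<xi>' - \<xi>)\<^sup>2 / \<xi>\<^sup>2 \<le> 2 * (8 * \<xi> * (norm h)\<^sup>2 + 2 * norm h ^ 4) / \<xi>\<^sup>2"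
      by (intro divide_right_mono mult_left_mono) auto
    also have "\<dots> = 16 * (norm h)\<^sup>2 / \<xi> + 4 * norm h ^ 4 / \<xi>\<^sup>2"
      using pos(1) by (simp add: field_simps power2_eq_square)
    also have "4 * norm h ^ 4 / \<xi>\<^sup>2 \<le> 4 * norm h ^ 4 / \<epsilon> ^ 4"
      using pos ge4 by (intro divide_left_mono) auto
    also have "\<dots> \<le> (4 + 256 * lyap (\<epsilon>\<^sup>2)) / \<epsilon> ^ 4 * norm h ^ 4"
      using l\<epsilon> pos by (simp add: divide_right_mono mult_right_mono)
    finally have a: "2 * (\<xi>' - \<xi>)\<^sup>2 / \<xi>\<^sup>2 \<le> 16 * (norm h)\<^sup>2 / \<xi> + (4 + 256 * lyap (\<epsilon>\<^sup>2)) / \<epsilon> ^ 4 * norm h ^ 4"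
      by simp
    \<comment> \<open>The part \<open>(norm h)\<^sup>2\<close> of the jump enters with a negative
      sign, because \<open>lyap\<close> decreases, and is dropped.\<close>
    have "2 * (\<eta> \<bullet> h) / (\<xi> * (1 + \<xi>)) \<le> (\<xi>' - \<xi>) / (\<xi> * (1 + \<xi>))"
      unfolding q using pos by (intro divide_right_mono) auto
    with a lyap_small_jump[OF pos(1) True] show ?thesis unfolding \<xi>'_def by linarith
  next
    case False
    then have neg: "\<xi>' - \<xi> < - \<xi> / 2" by linarith
    \<comment> \<open>A fall below half needs a negative inner product, so the linear term has the
      favourable sign.\<close>
    then have "\<eta> \<bullet> h \<le> 0" using q pos zero_le_power2[of "norm h"] by linarith
    then have a: "0 \<le> - (2 * (\<eta> \<bullet> h) / (\<xi> * (1 + \<xi>)))"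
      using pos by (simp add: divide_nonpos_pos)
    \<comment> \<open>Such a fall forces \<open>\<xi> \<le> 4 * (norm \<eta> * norm h)\<close> and
      hence \<open>\<epsilon> ^ 4 \<le> 256 * norm h ^ 4\<close>. This is the origin of
      \<open>256\<close>; it charges the crude bound \<open>lyap (\<epsilon>\<^sup>2)\<close> to the
      fourth-order term.\<close>
    have "\<xi> / 2 \<le> 2 * (norm \<eta> * norm h)"
      using neg q inner zero_le_power2[of "norm h"] by linarith
    then have "(\<xi> / 4)\<^sup>2 \<le> (norm \<eta> * norm h)\<^sup>2"
      using pos by (intro power_mono) auto
    also have "\<dots> \<le> \<xi> * (norm h)\<^sup>2"
      unfolding power_mult_distrib by (intro mult_right_mono ge) simp
    finally have "\<xi> / 16 \<le> (norm h)\<^sup>2"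
      using pos by (simp add: power2_eq_square)
    then have "(\<xi> / 16)\<^sup>2 \<le> ((norm h)\<^sup>2)\<^sup>2"
      using pos by (intro power_mono) auto
    then have "\<epsilon> ^ 4 \<le> 256 * norm h ^ 4" using ge4 by (simp add: power_divide)
    then have "1 \<le> 256 * norm h ^ 4 / \<epsilon> ^ 4" using pos by simp
    then have "lyap (\<epsilon>\<^sup>2) * 1 \<le> lyap (\<epsilon>\<^sup>2) * (256 * norm h ^ 4 / \<epsilon> ^ 4)"
      using l\<epsilon> by (intro mult_left_mono) auto
    also have "\<dots> \<le> (4 + 256 * lyap (\<epsilon>\<^sup>2)) / \<epsilon> ^ 4 * norm h ^ 4"
      using pos by (simp add: field_simps)
    finally have "lyap \<xi>' \<le> (4 + 256 * lyap (\<epsilon>\<^sup>2)) / \<epsilon> ^ 4 * norm h ^ 4" using l\<epsilon> by linarith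
    moreover have "0 \<le> 16 * (norm h)\<^sup>2 / \<xi>" using pos by simp
    ultimately show ?thesis using a l\<epsilon> unfolding \<xi>'_def by linarith
  qed
qed

text \<open>Here \<open>r\<close> is the norm of the true difference and \<open>\<zeta>\<close> that
  of its Euler sum. As the error is at most \<open>\<epsilon>\<close> and \<open>r\<close> at least
  \<open>\<epsilon>\<close>, the squares \<open>r\<^sup>2\<close> and
  \<open>\<zeta>\<^sup>2 + \<epsilon>\<^sup>2\<close> bound each other up to the factors
  \<open>2\<close> and \<open>5\<close>.\<close>

lemma lyap_transfer:
  fixes r \<zeta> \<epsilon> :: real
  assumes \<epsilon>: "0 < \<epsilon>" "\<epsilon> \<le> r" and \<zeta>: "0 \<le> \<zeta>" "r \<le> \<zeta> + \<epsilon>" "\<zeta> \<le> r + \<epsilon>"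
  shows "r\<^sup>2 \<le> 2 * (\<zeta>\<^sup>2 + \<epsilon>\<^sup>2)" "\<zeta> * r \<le> 2 * (\<zeta>\<^sup>2 + \<epsilon>\<^sup>2)" "lyap (r\<^sup>2) \<le> 3 * lyap (\<zeta>\<^sup>2 + \<epsilon>\<^sup>2)"
proof -
  have "r\<^sup>2 \<le> (\<zeta> + \<epsilon>)\<^sup>2" using assms by (intro power_mono) auto
  then show 1: "r\<^sup>2 \<le> 2 * (\<zeta>\<^sup>2 + \<epsilon>\<^sup>2)"
    using sum_squares_bound[of \<zeta> \<epsilon>] by (simp add: power2_sum)
  show "\<zeta> * r \<le> 2 * (\<zeta>\<^sup>2 + \<epsilon>\<^sup>2)"
  proof -
    have "\<zeta>\<^sup>2 + r\<^sup>2 \<le> 4 * (\<zeta>\<^sup>2 + \<epsilon>\<^sup>2)"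
      using 1 zero_le_power2[of \<epsilon>] zero_le_power2[of \<zeta>] by argo
    moreover have "2 * (\<zeta> * r) \<le> \<zeta>\<^sup>2 + r\<^sup>2" using sum_squares_bound[of \<zeta> r] by simp
    ultimately show ?thesis by linarith
  qed
  have "\<zeta>\<^sup>2 \<le> (r + \<epsilon>)\<^sup>2" "\<epsilon>\<^sup>2 \<le> r\<^sup>2" using assms by (auto intro!: power_mono)
  then have "\<zeta>\<^sup>2 + \<epsilon>\<^sup>2 \<le> 5 * r\<^sup>2"
    using sum_squares_bound[of r \<epsilon>] by (simp add: power2_sum)
  moreover have "0 < \<zeta>\<^sup>2 + \<epsilon>\<^sup>2" using \<epsilon> by (simp add: add_nonneg_pos)
  ultimately show "lyap (r\<^sup>2) \<le> 3 * lyap (\<zeta>\<^sup>2 + \<epsilon>\<^sup>2)"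
    by (intro order_trans[OF lyap_antimono lyap_scale_5]) auto
qed

text \<open>The bounds with \<open>K\<close> go where a multiple of \<open>lyap \<xi>\<close> must
  come out, that is, into the linear drift term and the quadratic noise term. The crude bounds
  \<open>a\<close> and \<open>b\<close> go into the remainders, which may depend on
  \<open>\<epsilon>\<close>. The term linear in \<open>D\<close> is kept exact, since only its mean
  vanishes.\<close>

lemma lyap_euler_step:
  fixes Z \<eta> \<beta> :: "real ^ 'd" and A :: "real ^ 'm ^ 'd" and D :: "real ^ 'm" and \<epsilon> K \<Delta> a b :: real
  assumes \<epsilon>: "0 < \<epsilon>" "\<epsilon> \<le> norm \<eta>" and K: "0 \<le> K" and \<Delta>: "0 \<le> \<Delta>" and close: "norm (Z - \<eta>) \<le> \<epsilon>"
    and A: "(norm A)\<^sup>2 \<le> K * (norm \<eta>)\<^sup>2 * lyap ((norm \<eta>)\<^sup>2)" "(norm A)\<^sup>2 \<le> a"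
    and \<beta>: "norm \<beta> \<le> K * norm \<eta> * lyap ((norm \<eta>)\<^sup>2)" "norm \<beta> \<le> b"
  defines "\<xi> \<equiv> (norm Z)\<^sup>2 + \<epsilon>\<^sup>2" and "c \<equiv> (4 + 256 * lyap (\<epsilon>\<^sup>2)) / \<epsilon> ^ 4"
  shows "lyap ((norm (Z + (\<Delta> *\<^sub>R \<beta> + A *v D)))\<^sup>2 + \<epsilon>\<^sup>2) \<le> (1 + 12 * K * \<Delta>) * lyap \<xi>
    + ((- (2 / (\<xi> * (1 + \<xi>)))) *\<^sub>R (Z v* A)) \<bullet> D + 192 * K * lyap \<xi> * (norm D)\<^sup>2
    + 8 * c * a\<^sup>2 * norm D ^ 4 + (32 * \<Delta>\<^sup>2 * b\<^sup>2 / \<epsilon>\<^sup>2 + 8 * c * \<Delta> ^ 4 * b ^ 4)"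
proof -
  define h where "h = \<Delta> *\<^sub>R \<beta> + A *v D"
  have pos: "0 < \<xi>" "0 < \<epsilon>\<^sup>2" "\<epsilon>\<^sup>2 \<le> \<xi>"
    using \<epsilon> by (simp_all add: \<xi>_def add_nonneg_pos)
  have l: "1 \<le> lyap \<xi>" "1 \<le> lyap (\<epsilon>\<^sup>2)" using lyap_ge_1[OF pos(1)] lyap_ge_1[OF pos(2)] by auto
  have c: "0 \<le> c" using l \<epsilon> by (simp add: c_def)
  have tri: "norm \<eta> \<le> norm Z + \<epsilon>" "norm Z \<le> norm \<eta> + \<epsilon>"
    using close norm_triangle_ineq2[of \<eta> Z] norm_triangle_ineq2[of Z \<eta>] norm_minus_commute[of Z \<eta>] by linarith+
  note tr = lyap_transfer[OF \<epsilon> norm_ge_zero tri, folded \<xi>_def]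
  have b: "0 \<le> b" using \<beta>(2) norm_ge_zero[of \<beta>] by linarith
  have a: "0 \<le> a" using A(2) zero_le_power2[of "norm A"] by linarith
  have l\<eta>: "0 \<le> lyap ((norm \<eta>)\<^sup>2)"
    using lyap_ge_1[of "(norm \<eta>)\<^sup>2"] \<epsilon> by force
  \<comment> \<open>\<open>6 = 2 * 3\<close> by the comparisons in \<open>lyap_transfer\<close>; it
    leads to \<open>12 = 2 * 6\<close> for the drift and \<open>192 = 16 * 2 * 6\<close> for the
    noise.\<close>
  have A2: "(norm A)\<^sup>2 \<le> 6 * K * \<xi> * lyap \<xi>"
  proof -
    have "K * (norm \<eta>)\<^sup>2 * lyap ((norm \<eta>)\<^sup>2) \<le> K * (2 * \<xi>) * (3 * lyap \<xi>)"
      using K by (intro mult_mono mult_left_mono tr l\<eta>) (auto intro: mult_nonneg_nonneg less_imp_le[OF pos(1)])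
    then show ?thesis using A(1) by simp
  qed
  have Z\<beta>: "norm Z * norm \<beta> \<le> 6 * K * \<xi> * lyap \<xi>"
  proof -
    have "norm Z * norm \<beta> \<le> norm Z * (K * norm \<eta> * lyap ((norm \<eta>)\<^sup>2))"
      using \<beta>(1) by (intro mult_left_mono) auto
    also have "\<dots> = K * (norm Z * norm \<eta>) * lyap ((norm \<eta>)\<^sup>2)" by simp
    also have "\<dots> \<le> K * (2 * \<xi>) * (3 * lyap \<xi>)"
      using K by (intro mult_mono mult_left_mono tr l\<eta>) (auto intro: mult_nonneg_nonneg less_imp_le[OF pos(1)])
    finally show ?thesis by simp
  qed
  have AD: "norm (A *v D) \<le> norm A * norm D" by (rule norm_matrix_vector_mult_le)
  have AD2: "(norm (A *v D))\<^sup>2 \<le> (norm A)\<^sup>2 * (norm D)\<^sup>2"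
    unfolding power_mult_distrib[symmetric] using AD by (intro power_mono) auto
  have \<beta>2: "(\<Delta> * norm \<beta>)\<^sup>2 \<le> \<Delta>\<^sup>2 * b\<^sup>2"
    unfolding power_mult_distrib using \<beta>(2) by (intro mult_left_mono power_mono) auto
  have "norm h \<le> \<Delta> * norm \<beta> + norm (A *v D)"
    unfolding h_def using norm_triangle_ineq[of "\<Delta> *\<^sub>R \<beta>" "A *v D"] \<Delta> by simp
  then have "(norm h)\<^sup>2 \<le> (\<Delta> * norm \<beta> + norm (A *v D))\<^sup>2"
    by (intro power_mono) auto
  also have "\<dots> \<le> 2 * (\<Delta> * norm \<beta>)\<^sup>2 + 2 * (norm (A *v D))\<^sup>2"
    using sum_squares_bound[of "\<Delta> * norm \<beta>" "norm (A *v D)"] by (simp add: power2_sum)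
  finally have h2: "(norm h)\<^sup>2 \<le> 2 * (\<Delta>\<^sup>2 * b\<^sup>2) + 2 * ((norm A)\<^sup>2 * (norm D)\<^sup>2)"
    using \<beta>2 AD2 by linarith
  have "16 * (norm h)\<^sup>2 / \<xi> \<le> 16 * (2 * (\<Delta>\<^sup>2 * b\<^sup>2) + 2 * ((6 * K * \<xi> * lyap \<xi>) * (norm D)\<^sup>2)) / \<xi>"
    using h2 mult_right_mono[OF A2 zero_le_power2[of "norm D"]] pos
    by (intro divide_right_mono mult_left_mono) linarith+
  also have "\<dots> = 32 * \<Delta>\<^sup>2 * b\<^sup>2 / \<xi> + 192 * K * lyap \<xi> * (norm D)\<^sup>2"
    using pos(1) by (simp add: field_simps)
  also have "32 * \<Delta>\<^sup>2 * b\<^sup>2 / \<xi> \<le> 32 * \<Delta>\<^sup>2 * b\<^sup>2 / \<epsilon>\<^sup>2"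
    by (intro divide_left_mono mult_pos_pos pos) auto
  finally have t2: "16 * (norm h)\<^sup>2 / \<xi> \<le> 32 * \<Delta>\<^sup>2 * b\<^sup>2 / \<epsilon>\<^sup>2 + 192 * K * lyap \<xi> * (norm D)\<^sup>2" by simp
  have "(norm h)\<^sup>2 \<le> 2 * (\<Delta>\<^sup>2 * b\<^sup>2) + 2 * (a * (norm D)\<^sup>2)"
    using h2 mult_right_mono[OF A(2) zero_le_power2[of "norm D"]] by linarith
  then have "((norm h)\<^sup>2)\<^sup>2 \<le> (2 * (\<Delta>\<^sup>2 * b\<^sup>2) + 2 * (a * (norm D)\<^sup>2))\<^sup>2"
    by (intro power_mono) auto
  also have "\<dots> \<le> 2 * (2 * (\<Delta>\<^sup>2 * b\<^sup>2))\<^sup>2 + 2 * (2 * (a * (norm D)\<^sup>2))\<^sup>2"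
    using sum_squares_bound[of "2 * (\<Delta>\<^sup>2 * b\<^sup>2)" "2 * (a * (norm D)\<^sup>2)"] by (simp only: power2_sum)
  finally have "norm h ^ 4 \<le> 8 * \<Delta> ^ 4 * b ^ 4 + 8 * a\<^sup>2 * norm D ^ 4"
    by (simp add: power_mult_distrib)
  from mult_left_mono[OF this c]
  have t4: "c * norm h ^ 4 \<le> 8 * c * \<Delta> ^ 4 * b ^ 4 + 8 * c * a\<^sup>2 * norm D ^ 4"
    by (simp add: algebra_simps)
  have t1: "- (2 * (Z \<bullet> h) / (\<xi> * (1 + \<xi>))) \<le> 12 * K * \<Delta> * lyap \<xi> + ((- (2 / (\<xi> * (1 + \<xi>)))) *\<^sub>R (Z v* A)) \<bullet> D"
  proof -
    have "- (2 * (Z \<bullet> h) / (\<xi> * (1 + \<xi>))) =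
        2 * \<Delta> * (- (Z \<bullet> \<beta>)) / (\<xi> * (1 + \<xi>)) + ((- (2 / (\<xi> * (1 + \<xi>)))) *\<^sub>R (Z v* A)) \<bullet> D"
      by (simp add: h_def inner_add_right dot_lmul_matrix add_divide_distrib distrib_left)
    moreover have "2 * \<Delta> * (- (Z \<bullet> \<beta>)) / (\<xi> * (1 + \<xi>)) \<le> 2 * \<Delta> * (6 * K * \<xi> * lyap \<xi>) / \<xi>"
    proof (rule frac_le)
      show "2 * \<Delta> * (- (Z \<bullet> \<beta>)) \<le> 2 * \<Delta> * (6 * K * \<xi> * lyap \<xi>)"
        using Z\<beta> Cauchy_Schwarz_ineq2[of Z \<beta>] \<Delta> by (intro mult_left_mono) auto
      show "0 \<le> 2 * \<Delta> * (6 * K * \<xi> * lyap \<xi>)"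
        using \<Delta> K l(1) less_imp_le[OF pos(1)] by simp
      show "\<xi> \<le> \<xi> * (1 + \<xi>)" using pos(1) by (simp add: algebra_simps)
    qed (fact pos(1))
    moreover have "2 * \<Delta> * (6 * K * \<xi> * lyap \<xi>) / \<xi> = 12 * K * \<Delta> * lyap \<xi>"
      using pos(1) by simp
    ultimately show ?thesis by linarith
  qed
  have "lyap ((norm (Z + h))\<^sup>2 + \<epsilon>\<^sup>2) \<le> lyap \<xi> - 2 * (Z \<bullet> h) / (\<xi> * (1 + \<xi>)) + 16 * (norm h)\<^sup>2 / \<xi> + c * norm h ^ 4"
    using lyap_step[OF \<epsilon>(1), of Z h] by (simp only: \<xi>_def c_def)
  moreover have "(1 + 12 * K * \<Delta>) * lyap \<xi> = lyap \<xi> + 12 * K * \<Delta> * lyap \<xi>"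
    by (simp add: algebra_simps)
  ultimately show ?thesis
    using t1 t2 t4 unfolding h_def[symmetric] by linarith
qed

text \<open>For \<open>r = \<bar>u - v\<bar>\<close> the two terms of the hypothesis balance at \<open>N\<close> of order \<open>r powr (- 2 / \<mu>)\<close>.\<close>

lemma log_scale_choice:
  fixes R \<mu> :: real
  assumes R: "0 \<le> R" and \<mu>: "0 < \<mu>"
  obtains K where "0 \<le> K" and "\<And>r. 0 < r \<Longrightarrow> \<exists>N::nat. exp 1 < real N \<and> R \<le> real N \<and>
    ln (real N) \<le> K * lyap (r\<^sup>2) \<and> ln (real N) / real N powr \<mu> \<le> K * r"
proof -
  \<comment> \<open>The first three summands bound \<open>ln N\<close> in units of
    \<open>lyap\<close>, the last one bounds \<open>ln N / N powr \<mu>\<close> in units of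
    \<open>r\<close>.\<close>
  define K where "K = ln (R + 4) + ln 2 + 1 / \<mu> + 2 / \<mu>"
  have lnR: "0 \<le> ln (R + 4)" using R by simp
  have K: "0 \<le> K" using lnR \<mu> by (simp add: K_def)
  have "\<exists>N::nat. exp 1 < real N \<and> R \<le> real N \<and>
      ln (real N) \<le> K * lyap (r\<^sup>2) \<and> ln (real N) / real N powr \<mu> \<le> K * r" if r: "0 < r" for r
  proof (intro exI conjI)
    define p where "p = r powr (- 2 / \<mu>)"
    \<comment> \<open>The summand \<open>3\<close> ensures \<open>N > exp 1\<close>,
      \<open>R\<close> covers the ball, and \<open>p\<close> sets the scale.\<close>
    define N where "N = nat \<lceil>R + 3 + p\<rceil>"
    have p: "0 < p" using r by (simp add: p_def)
    have N: "R + 3 + p \<le> real N" "real N \<le> R + 4 + p"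
      unfolding N_def using R p by linarith+
    have N3: "3 < real N" using N R p by linarith
    show "exp 1 < real N" using N3 exp_le by linarith
    show "R \<le> real N" using N p by linarith
    have lyap1: "1 \<le> lyap (r\<^sup>2)" using r by (intro lyap_ge_1) simp
    have "p = (1 / r\<^sup>2) powr (1 / \<mu>)"
    proof -
      have "1 / r\<^sup>2 = r powr (- 2)" using r by (simp add: powr_minus powr_numeral divide_inverse)
      then show ?thesis by (simp add: p_def powr_powr)
    qed
    also have "\<dots> \<le> (1 + 1 / r\<^sup>2) powr (1 / \<mu>)"
      using \<mu> r by (intro powr_mono2) auto
    finally have p_le: "p \<le> (1 + 1 / r\<^sup>2) powr (1 / \<mu>)" .
    moreover have "1 \<le> (1 + 1 / r\<^sup>2) powr (1 / \<mu>)"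
      using \<mu> r by (intro ge_one_powr_ge_zero) auto
    ultimately have "1 + p \<le> 2 * (1 + 1 / r\<^sup>2) powr (1 / \<mu>)" by linarith
    then have "ln (1 + p) \<le> ln (2 * (1 + 1 / r\<^sup>2) powr (1 / \<mu>))"
      using p by (intro ln_mono) auto
    also have "\<dots> = ln 2 + ln (1 + 1 / r\<^sup>2) / \<mu>"
      using r by (subst ln_mult) (auto simp: ln_powr add_pos_pos add_nonneg_eq_0_iff)
    finally have ln_p: "ln (1 + p) \<le> ln 2 + ln (1 + 1 / r\<^sup>2) / \<mu>" .
    have "R + 4 + p \<le> (R + 4) * (1 + p)" using R p by (simp add: algebra_simps)
    then have "ln (real N) \<le> ln ((R + 4) * (1 + p))"
      using N N3 by simp
    also have "\<dots> = ln (R + 4) + ln (1 + p)" using R p by (intro ln_mult_pos) auto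
    also have "\<dots> \<le> (ln (R + 4) + ln 2) * 1 + 1 / \<mu> * ln (1 + 1 / r\<^sup>2)" using ln_p by simp
    also have "\<dots> \<le> (ln (R + 4) + ln 2) * lyap (r\<^sup>2) + 1 / \<mu> * lyap (r\<^sup>2)"
      using lyap1 lnR \<mu> by (intro add_mono mult_left_mono) (auto simp: lyap_def)
    also have "\<dots> = (ln (R + 4) + ln 2 + 1 / \<mu>) * lyap (r\<^sup>2)" by (simp add: algebra_simps)
    also have "\<dots> \<le> K * lyap (r\<^sup>2)"
      using lyap1 \<mu> by (intro mult_right_mono) (auto simp: K_def divide_right_mono)
    finally show "ln (real N) \<le> K * lyap (r\<^sup>2)" .
    \<comment> \<open>Half of the exponent \<open>\<mu>\<close> pays for the logarithm; the other
      half leaves \<open>p powr (- (\<mu> / 2)) = r\<close>, which explains the exponent in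
      \<open>p\<close>.\<close>
    have "ln (real N) \<le> real N powr (\<mu> / 2) / (\<mu> / 2)"
      using N3 \<mu> by (intro ln_powr_bound) auto
    then have "ln (real N) / real N powr \<mu> \<le> real N powr (\<mu> / 2) / (\<mu> / 2) / real N powr \<mu>"
      by (intro divide_right_mono) auto
    also have "\<dots> = 2 / \<mu> * real N powr (- (\<mu> / 2))"
    proof -
      have "real N powr \<mu> = real N powr (\<mu> / 2) * real N powr (\<mu> / 2)"
        by (simp add: powr_add[symmetric])
      then show ?thesis using N3 by (simp add: powr_minus field_simps)
    qed
    also have "\<dots> \<le> 2 / \<mu> * p powr (- (\<mu> / 2))"
      using \<mu> p N R by (intro mult_left_mono powr_mono2') auto
    also have "p powr (- (\<mu> / 2)) = r"
      using \<mu> r by (simp add: p_def powr_powr)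
    also have "2 / \<mu> * r \<le> K * r"
    proof (intro mult_right_mono)
      have "0 \<le> 1 / \<mu>" "0 \<le> ln (2::real)" using \<mu> by simp_all
      then show "2 / \<mu> \<le> K" using lnR unfolding K_def by linarith
    qed (use r in simp)
    finally show "ln (real N) / real N powr \<mu> \<le> K * r" .
  qed
  with K show ?thesis by (rule that)
qed

text \<open>The constant \<open>C\<close> is the same for every \<open>N\<close>, so
  \<open>N\<close> may be chosen for each pair from \<open>r = norm (u - v)\<close>. The additive
  error becomes a multiple of \<open>r\<close>, and \<open>1 \<le> lyap (r\<^sup>2)\<close> merges
  it with the logarithmic term.\<close>

lemma log_lipschitz_modulus:
  fixes \<sigma> :: "'a::real_normed_vector \<Rightarrow> 'b::real_normed_vector" and b :: "'a \<Rightarrow> 'c::real_normed_vector"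
    and C \<mu> R :: real
  assumes R: "0 \<le> R" and C: "0 < C" and \<mu>: "0 < \<mu>"
    and \<sigma>: "\<And>(N::nat) u v. real N > exp 1 \<Longrightarrow> norm u \<le> real N \<Longrightarrow> norm v \<le> real N \<Longrightarrow>
      norm (\<sigma> u - \<sigma> v) \<le> C * sqrt (ln (real N)) * norm (u - v) + C * ln (real N) / real N powr \<mu>"
    and b: "\<And>(N::nat) u v. real N > exp 1 \<Longrightarrow> norm u \<le> real N \<Longrightarrow> norm v \<le> real N \<Longrightarrow>
      norm (b u - b v) \<le> C * ln (real N) * norm (u - v) + C * ln (real N) / real N powr \<mu>"
  shows "\<exists>K\<ge>0. \<forall>u v. norm u \<le> R \<longrightarrow> norm v \<le> R \<longrightarrow> u \<noteq> v \<longrightarrow>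
    (norm (\<sigma> u - \<sigma> v))\<^sup>2 \<le> K * (norm (u - v))\<^sup>2 * lyap ((norm (u - v))\<^sup>2) \<and>
    norm (b u - b v) \<le> K * norm (u - v) * lyap ((norm (u - v))\<^sup>2)"
proof -
  obtain K where K: "0 \<le> K" and N: "\<And>r. 0 < r \<Longrightarrow> \<exists>N::nat. exp 1 < real N \<and> R \<le> real N \<and>
      ln (real N) \<le> K * lyap (r\<^sup>2) \<and> ln (real N) / real N powr \<mu> \<le> K * r"
    using log_scale_choice[OF R \<mu>] by blast
  \<comment> \<open>The first two summands stem from squaring the two parts of the bound for
    \<open>\<sigma>\<close>, the last one from the bound for \<open>b\<close>.\<close>
  define L where "L = 2 * C\<^sup>2 * K + 2 * C\<^sup>2 * K\<^sup>2 + 2 * C * K"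
  have L: "0 \<le> L" using K C by (simp add: L_def)
  have bounds: "(norm (\<sigma> u - \<sigma> v))\<^sup>2 \<le> L * (norm (u - v))\<^sup>2 * lyap ((norm (u - v))\<^sup>2) \<and>
      norm (b u - b v) \<le> L * norm (u - v) * lyap ((norm (u - v))\<^sup>2)"
    if u: "norm u \<le> R" and v: "norm v \<le> R" and ne: "u \<noteq> v" for u v
  proof -
    define r where "r = norm (u - v)"
    define l where "l = lyap (r\<^sup>2)"
    have r: "0 < r" using ne by (simp add: r_def)
    have l: "1 \<le> l" using r by (simp add: l_def lyap_ge_1)
    obtain N :: nat where N: "exp 1 < real N" "R \<le> real N" "ln (real N) \<le> K * l"
        "ln (real N) / real N powr \<mu> \<le> K * r"
      using N[OF r] unfolding l_def by blast
    have uv: "norm u \<le> real N" "norm v \<le> real N" using u v N(2) by linarith+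
    have CK: "C * ln (real N) / real N powr \<mu> \<le> C * (K * r)"
      using mult_left_mono[OF N(4)] C by simp
    have "norm (\<sigma> u - \<sigma> v) \<le> C * sqrt (K * l) * r + C * (K * r)"
    proof -
      have "C * sqrt (ln (real N)) * r \<le> C * sqrt (K * l) * r"
        using C r N(3) by (intro mult_right_mono mult_left_mono) auto
      then show ?thesis using \<sigma>[OF N(1) uv] CK unfolding r_def by linarith
    qed
    then have "(norm (\<sigma> u - \<sigma> v))\<^sup>2 \<le> (C * sqrt (K * l) * r + C * (K * r))\<^sup>2"
      by (intro power_mono) auto
    also have "\<dots> \<le> 2 * (C * sqrt (K * l) * r)\<^sup>2 + 2 * (C * (K * r))\<^sup>2"
      using sum_squares_bound[of "C * sqrt (K * l) * r" "C * (K * r)"] by (simp only: power2_sum)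
    also have "\<dots> = 2 * C\<^sup>2 * K * r\<^sup>2 * l + 2 * C\<^sup>2 * K\<^sup>2 * r\<^sup>2 * 1"
      using K l by (simp add: power_mult_distrib)
    also have "\<dots> \<le> 2 * C\<^sup>2 * K * r\<^sup>2 * l + 2 * C\<^sup>2 * K\<^sup>2 * r\<^sup>2 * l"
      using l K by (intro add_left_mono mult_left_mono) auto
    also have "\<dots> = (2 * C\<^sup>2 * K + 2 * C\<^sup>2 * K\<^sup>2) * r\<^sup>2 * l" by (simp add: algebra_simps)
    also have "\<dots> \<le> L * r\<^sup>2 * l"
      using l K C by (intro mult_right_mono) (auto simp: L_def)
    finally have 1: "(norm (\<sigma> u - \<sigma> v))\<^sup>2 \<le> L * r\<^sup>2 * l" .
    have "C * ln (real N) * r \<le> C * (K * l) * r"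
      using C r N(3) by (intro mult_right_mono mult_left_mono) auto
    then have "norm (b u - b v) \<le> C * (K * l) * r + C * (K * r) * 1"
      using b[OF N(1) uv] CK unfolding r_def by linarith
    also have "\<dots> \<le> C * (K * l) * r + C * (K * r) * l"
      using C K r l by (intro add_left_mono mult_left_mono) auto
    also have "\<dots> = 2 * C * K * r * l" by (simp add: algebra_simps)
    also have "\<dots> \<le> L * r * l"
      using l r K C by (intro mult_right_mono) (auto simp: L_def)
    finally show ?thesis using 1 unfolding r_def l_def by blast
  qed
  show ?thesis using L bounds by blast
qed

section \<open>Avoiding the origin\<close>

text \<open>Each step uses \<open>1 + L \<le> exp L\<close>; the additive \<open>c\<close> is
  enlarged to \<open>exp (L * Suc k) * c\<close> so that the induction closes.\<close>

lemma discrete_gronwall: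
  fixes a :: "nat \<Rightarrow> real"
  assumes L: "0 \<le> L" and c: "0 \<le> c" and a0: "0 \<le> a 0"
    and step: "\<And>k. a (Suc k) \<le> (1 + L) * a k + c"
  shows "a k \<le> exp (L * k) * (a 0 + c * k)"
proof (induction k)
  case (Suc k)
  have "a (Suc k) \<le> (1 + L) * (exp (L * k) * (a 0 + c * k)) + 1 * c"
    using step[of k] mult_left_mono[OF Suc.IH, of "1 + L"] L by linarith
  also have "\<dots> \<le> exp L * (exp (L * k) * (a 0 + c * k)) + exp (L * Suc k) * c"
    using a0 c L exp_ge_add_one_self[of L] by (intro add_mono mult_right_mono) auto
  also have "\<dots> = exp (L * Suc k) * (a 0 + c * Suc k)"
    by (simp add: exp_add algebra_simps)
  finally show ?case .
qed simp

context ito_process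
begin

text \<open>\<open>G\<close> localises to a region where \<open>K\<close> is valid and is tested at
  grid times only. The constant \<open>c\<close> may depend on \<open>\<epsilon>\<close> and
  \<open>r\<close>, but the exponential does not, so the mesh can be sent to \<open>0\<close> before
  \<open>\<epsilon>\<close>.\<close>

lemma euler_lyapunov:
  fixes G :: "real \<Rightarrow> 'w \<Rightarrow> bool" and K r \<epsilon> :: real
  assumes G: "\<And>t. 0 \<le> t \<Longrightarrow> Measurable.pred (F t) (G t)"
    and K: "0 \<le> K" and r: "0 \<le> r" and \<epsilon>: "0 < \<epsilon>"
    and A_le: "\<And>t \<omega>. 0 \<le> t \<Longrightarrow> \<omega> \<in> space M \<Longrightarrow> G t \<omega> \<Longrightarrow> \<eta> t \<omega> \<noteq> 0 \<Longrightarrow>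
      (norm (A t \<omega>))\<^sup>2 \<le> K * (norm (\<eta> t \<omega>))\<^sup>2 * lyap ((norm (\<eta> t \<omega>))\<^sup>2)"
    and \<beta>_le: "\<And>t \<omega>. 0 \<le> t \<Longrightarrow> \<omega> \<in> space M \<Longrightarrow> G t \<omega> \<Longrightarrow> \<eta> t \<omega> \<noteq> 0 \<Longrightarrow>
      norm (\<beta> t \<omega>) \<le> K * norm (\<eta> t \<omega>) * lyap ((norm (\<eta> t \<omega>))\<^sup>2)"
    and \<eta>_le: "\<And>t \<omega>. 0 \<le> t \<Longrightarrow> \<omega> \<in> space M \<Longrightarrow> G t \<omega> \<Longrightarrow> norm (\<eta> t \<omega>) \<le> r"
  shows "\<exists>c. \<forall>n>0.
    prob ({\<omega>\<in>space M. (\<forall>k\<le>n. G (grid n k) \<omega>) \<and> (\<exists>k\<le>n. norm (\<eta> (grid n k) \<omega>) < \<epsilon>)} - euler_error n \<epsilon>)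
      * lyap (5 * \<epsilon>\<^sup>2)
    \<le> exp ((12 * K + 192 * K * CARD('m)) * T) * (lyap ((norm z)\<^sup>2 + \<epsilon>\<^sup>2) + c / n)"
proof -
  define a where "a = K * r\<^sup>2 * lyap (\<epsilon>\<^sup>2)"
  define b where "b = K * r * lyap (\<epsilon>\<^sup>2)"
  define C where "C = (4 + 256 * lyap (\<epsilon>\<^sup>2)) / \<epsilon> ^ 4"
  define L where "L = 12 * K + 192 * K * CARD('m)"
  define c where "c = 8 * C * a\<^sup>2 * (3 * (real CARD('m))\<^sup>2) + 32 * b\<^sup>2 / \<epsilon>\<^sup>2 + 8 * C * T\<^sup>2 * b ^ 4"
  have l\<epsilon>: "1 \<le> lyap (\<epsilon>\<^sup>2)" using \<epsilon> by (intro lyap_ge_1) simp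
  have nn: "0 \<le> a" "0 \<le> b" "0 \<le> C" "0 \<le> L"
    using K r l\<epsilon> \<epsilon> by (simp_all add: a_def b_def C_def L_def)
  then have c: "0 \<le> c" by (simp add: c_def)
  have bound: "prob ({\<omega>\<in>space M. (\<forall>k\<le>n. G (grid n k) \<omega>) \<and> (\<exists>k\<le>n. norm (\<eta> (grid n k) \<omega>) < \<epsilon>)} - euler_error n \<epsilon>)
      * lyap (5 * \<epsilon>\<^sup>2) \<le> exp (L * T) * (lyap ((norm z)\<^sup>2 + \<epsilon>\<^sup>2) + c * T\<^sup>2 / n)" if n: "0 < n" for n
  proof -
    define \<Delta> where "\<Delta> = T / n"
    define t where "t k = grid n k" for k
    define D where "D i \<omega> = W (t (Suc i)) \<omega> - W (t i) \<omega>" for i \<omega>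
    \<comment> \<open>All three conditions are known at time \<open>t j\<close>, so freezing at the
      first failure leaves the coefficients adapted. The last two are what
      \<open>lyap_transfer\<close> asks for.\<close>
    define good where "good j \<omega> \<longleftrightarrow> G (t j) \<omega> \<and> \<epsilon> \<le> norm (\<eta> (t j) \<omega>) \<and>
      norm (euler n j \<omega> - \<eta> (t j) \<omega>) \<le> \<epsilon>" for j \<omega>
    define Q where "Q k \<omega> \<longleftrightarrow> (\<forall>j\<le>k. good j \<omega>)" for k \<omega>
    define A' where "A' i \<omega> = (if Q i \<omega> then A (t i) \<omega> else 0)" for i \<omega>
    define \<beta>' where "\<beta>' i \<omega> = (if Q i \<omega> then \<beta> (t i) \<omega> else 0)" for i \<omega>
    define Z where "Z k \<omega> = z + (\<Sum>i<k. \<Delta> *\<^sub>R \<beta>' i \<omega>) + (\<Sum>i<k. A' i \<omega> *v D i \<omega>)" for k \<omega>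
    define \<xi> where "\<xi> k \<omega> = (norm (Z k \<omega>))\<^sup>2 + \<epsilon>\<^sup>2" for k \<omega>
    define U where "U k \<omega> = lyap (\<xi> k \<omega>)" for k \<omega>
    have \<Delta>: "0 < \<Delta>" "\<Delta> \<le> T" using T_pos n by (simp_all add: \<Delta>_def field_simps)
    have t0: "0 \<le> t k" for k by (simp add: t_def grid_nonneg)
    have t_mono: "i \<le> j \<Longrightarrow> t i \<le> t j" for i j by (simp add: t_def grid_mono)
    have t_lt: "t k < t (Suc k)" for k
      using strict_mono_less[OF grid_strict_mono[OF n]] by (simp add: t_def)
    have t_diff: "t (Suc k) - t k = \<Delta>" for k by (simp add: t_def grid_Suc_diff \<Delta>_def)
    have good_F: "Measurable.pred (F (t k)) (good k)" for k
    proof -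
      note [measurable] = G[OF t0] \<eta>_adapted[OF t0] euler_F[OF n, folded t_def]
      show ?thesis unfolding good_def by measurable
    qed
    have Q_F: "Measurable.pred (F (t k)) (Q k)" for k
    proof -
      have "Measurable.pred (F (t k)) (\<lambda>\<omega>. \<forall>j\<in>{..k}. good j \<omega>)"
      proof (intro pred_intros_finite)
        fix j assume "j \<in> {..k}"
        then show "Measurable.pred (F (t k)) (good j)"
          by (intro measurable_F_mono[OF t0 t_mono good_F]) simp
      qed simp
      also have "(\<lambda>\<omega>. \<forall>j\<in>{..k}. good j \<omega>) = Q k"
        by (auto simp: Q_def fun_eq_iff)
      finally show ?thesis .
    qed
    have A'_F: "A' k \<in> borel_measurable (F (t k))" for k
      unfolding A'_def using A_adapted[OF t0[of k]] Q_F[of k] by (intro measurable_If) (auto simp: pred_def)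
    have \<beta>'_F: "\<beta>' k \<in> borel_measurable (F (t k))" for k
      unfolding \<beta>'_def using \<beta>_adapted[OF t0[of k]] Q_F[of k] by (intro measurable_If) (auto simp: pred_def)
    have Z_F: "Z k \<in> borel_measurable (F (t k))" for k
    proof -
      have "(\<lambda>\<omega>. \<Sum>i<k. A' i \<omega> *v D i \<omega>) \<in> borel_measurable (F (t k))"
        unfolding D_def t_def
        by (rule brownian_sum_measurable[OF grid_strict_mono[OF n] _ A'_F[unfolded t_def]]) (simp add: grid_0)
      moreover have "(\<lambda>\<omega>. \<Sum>i<k. \<Delta> *\<^sub>R \<beta>' i \<omega>) \<in> borel_measurable (F (t k))"
      proof (intro borel_measurable_sum borel_measurable_scaleR borel_measurable_const)
        fix i assume "i \<in> {..<k}"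
        then show "\<beta>' i \<in> borel_measurable (F (t k))"
          by (intro measurable_F_mono[OF t0 t_mono \<beta>'_F]) simp
      qed
      ultimately show ?thesis
        unfolding Z_def by (intro borel_measurable_add borel_measurable_const)
    qed
    have \<xi>_pos: "0 < \<xi> k \<omega>" "\<epsilon>\<^sup>2 \<le> \<xi> k \<omega>" for k \<omega>
      using \<epsilon> by (simp_all add: \<xi>_def add_nonneg_pos)
    \<comment> \<open>The added \<open>\<epsilon>\<^sup>2\<close> bounds \<open>U\<close> whatever
      the value of \<open>Z\<close>, which makes it integrable.\<close>
    have U_bounds: "1 \<le> U k \<omega>" "U k \<omega> \<le> lyap (\<epsilon>\<^sup>2)" for k \<omega>
      unfolding U_def using lyap_ge_1[OF \<xi>_pos(1)] lyap_antimono[OF _ \<xi>_pos(2)] \<epsilon> by auto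
    have U_F: "U k \<in> borel_measurable (F (t k))" for k
    proof -
      note [measurable] = Z_F
      show ?thesis unfolding U_def \<xi>_def lyap_def by measurable
    qed
    have U_int: "integrable M (U k)" for k
    proof (rule integrable_const_bound[of _ "lyap (\<epsilon>\<^sup>2)"])
      show "AE \<omega> in M. norm (U k \<omega>) \<le> lyap (\<epsilon>\<^sup>2)"
        using U_bounds(2)[of k] order_trans[OF zero_le_one U_bounds(1)[of k]] by (intro AE_I2) simp
    qed (rule measurable_F_M[OF t0 U_F])
    have Z_stop: "Z m \<omega> = euler n k \<omega>" if "\<And>j. j < k \<Longrightarrow> good j \<omega>" "k \<le> m" "k = m \<or> \<not> good k \<omega>" for k m \<omega>
    proof -
      let ?inc = "\<lambda>i. \<Delta> *\<^sub>R \<beta> (t i) \<omega> + A (t i) \<omega> *v D i \<omega>"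
      have "Z m \<omega> = z + (\<Sum>i<m. if Q i \<omega> then ?inc i else 0)"
        unfolding Z_def add.assoc sum.distrib[symmetric]
        by (intro arg_cong2[of _ _ _ _ "(+)"] sum.cong) (auto simp: \<beta>'_def A'_def)
      also have "(\<Sum>i<m. if Q i \<omega> then ?inc i else 0) = (\<Sum>i<k. ?inc i)"
        unfolding Q_def by (rule sum_stopped[of k "\<lambda>j. good j \<omega>"]) (use that in auto)
      also have "z + \<dots> = euler n k \<omega>"
        by (simp add: euler_def R_def S_def sum.distrib t_def D_def \<Delta>_def)
      finally show ?thesis .
    qed
    have Q_facts: "G (t k) \<omega>" "\<epsilon> \<le> norm (\<eta> (t k) \<omega>)" "norm (Z k \<omega> - \<eta> (t k) \<omega>) \<le> \<epsilon>" if "Q k \<omega>" for k \<omega>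
      using that Z_stop[of k \<omega> k] unfolding Q_def good_def by auto
    have coeff: "(norm (A (t k) \<omega>))\<^sup>2 \<le> K * (norm (\<eta> (t k) \<omega>))\<^sup>2 * lyap ((norm (\<eta> (t k) \<omega>))\<^sup>2)"
        "(norm (A (t k) \<omega>))\<^sup>2 \<le> a"
        "norm (\<beta> (t k) \<omega>) \<le> K * norm (\<eta> (t k) \<omega>) * lyap ((norm (\<eta> (t k) \<omega>))\<^sup>2)"
        "norm (\<beta> (t k) \<omega>) \<le> b"
      if \<omega>: "\<omega> \<in> space M" and "Q k \<omega>" for k \<omega>
    proof -
      note q = Q_facts[OF that(2)]
      have ne: "\<eta> (t k) \<omega> \<noteq> 0" using q(2) \<epsilon> by auto
      have \<eta>r: "norm (\<eta> (t k) \<omega>) \<le> r" by (rule \<eta>_le[OF t0 \<omega> q(1)])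
      have "\<epsilon>\<^sup>2 \<le> (norm (\<eta> (t k) \<omega>))\<^sup>2" using q(2) \<epsilon> by (intro power_mono) auto
      then have l: "lyap ((norm (\<eta> (t k) \<omega>))\<^sup>2) \<le> lyap (\<epsilon>\<^sup>2)" using \<epsilon> by (intro lyap_antimono) auto
      have l0: "0 \<le> lyap ((norm (\<eta> (t k) \<omega>))\<^sup>2)"
        using lyap_ge_1[of "(norm (\<eta> (t k) \<omega>))\<^sup>2"] ne by force
      show 1: "(norm (A (t k) \<omega>))\<^sup>2 \<le> K * (norm (\<eta> (t k) \<omega>))\<^sup>2 * lyap ((norm (\<eta> (t k) \<omega>))\<^sup>2)"
        by (rule A_le[OF t0 \<omega> q(1) ne])
      show 2: "norm (\<beta> (t k) \<omega>) \<le> K * norm (\<eta> (t k) \<omega>) * lyap ((norm (\<eta> (t k) \<omega>))\<^sup>2)"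
        by (rule \<beta>_le[OF t0 \<omega> q(1) ne])
      show "(norm (A (t k) \<omega>))\<^sup>2 \<le> a"
        by (rule order_trans[OF 1], unfold a_def, intro mult_mono mult_left_mono power_mono l \<eta>r l0)
          (use K r in auto)
      show "norm (\<beta> (t k) \<omega>) \<le> b"
        by (rule order_trans[OF 2], unfold b_def, intro mult_mono mult_left_mono l \<eta>r l0)
          (use K r in auto)
    qed
    define g where "g k \<omega> = (- (2 / (\<xi> k \<omega> * (1 + \<xi> k \<omega>)))) *\<^sub>R (Z k \<omega> v* A' k \<omega>)" for k \<omega>
    have g_F: "g k \<in> borel_measurable (F (t k))" for k
    proof -
      note [measurable] = Z_F A'_F
      show ?thesis unfolding g_def \<xi>_def by measurable
    qed
    \<comment> \<open>After freezing \<open>A'\<close> is zero; before it, \<open>Z\<close> is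
      within \<open>\<epsilon>\<close> of \<open>\<eta>\<close>, which \<open>G\<close> keeps in the
      ball of radius \<open>r\<close>.\<close>
    have g_bound: "norm (g k \<omega>) \<le> 2 / \<epsilon>\<^sup>2 * ((r + \<epsilon>) * sqrt a)" if \<omega>: "\<omega> \<in> space M" for k \<omega>
    proof (cases "Q k \<omega>")
      case True
      have "norm (Z k \<omega>) \<le> r + \<epsilon>"
        using Q_facts(3)[OF True] \<eta>_le[OF t0 \<omega> Q_facts(1)[OF True]]
          norm_triangle_ineq2[of "Z k \<omega>" "\<eta> (t k) \<omega>"] by linarith
      moreover have "norm (A' k \<omega>) \<le> sqrt a"
        using coeff(2)[OF \<omega> True] True by (intro real_le_rsqrt) (simp add: A'_def)
      ultimately have "norm (Z k \<omega>) * norm (A' k \<omega>) \<le> (r + \<epsilon>) * sqrt a"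
        using r \<epsilon> by (intro mult_mono) auto
      then have 1: "norm (Z k \<omega> v* A' k \<omega>) \<le> (r + \<epsilon>) * sqrt a"
        using norm_vector_matrix_mult_le[of "Z k \<omega>" "A' k \<omega>"] by linarith
      have "\<epsilon>\<^sup>2 * 1 \<le> \<xi> k \<omega> * (1 + \<xi> k \<omega>)"
        using \<xi>_pos[of k \<omega>] \<epsilon> by (intro mult_mono) auto
      then have 2: "\<bar>- (2 / (\<xi> k \<omega> * (1 + \<xi> k \<omega>)))\<bar> \<le> 2 / \<epsilon>\<^sup>2"
        using \<xi>_pos(1)[of k \<omega>] \<epsilon> by (simp add: frac_le)
      show ?thesis unfolding g_def norm_scaleR
        using 1 2 \<epsilon> by (intro mult_mono) auto
    qed (use r nn \<epsilon> in \<open>simp add: g_def A'_def\<close>)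
    have step: "U (Suc k) \<omega> \<le> (1 + 12 * K * \<Delta>) * U k \<omega> + g k \<omega> \<bullet> D k \<omega> + 192 * K * U k \<omega> * (norm (D k \<omega>))\<^sup>2
        + 8 * C * a\<^sup>2 * norm (D k \<omega>) ^ 4 + (32 * \<Delta>\<^sup>2 * b\<^sup>2 / \<epsilon>\<^sup>2 + 8 * C * \<Delta> ^ 4 * b ^ 4)"
      if \<omega>: "\<omega> \<in> space M" for k \<omega>
    proof -
      have Zs: "Z (Suc k) \<omega> = Z k \<omega> + (\<Delta> *\<^sub>R \<beta>' k \<omega> + A' k \<omega> *v D k \<omega>)"
        by (simp add: Z_def)
      show ?thesis
      proof (cases "Q k \<omega>")
        case True
        then have AB: "A' k \<omega> = A (t k) \<omega>" "\<beta>' k \<omega> = \<beta> (t k) \<omega>" by (simp_all add: A'_def \<beta>'_def)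
        show ?thesis
          unfolding U_def \<xi>_def g_def Zs AB C_def
          by (rule lyap_euler_step[OF \<epsilon> Q_facts(2)[OF True] K less_imp_le[OF \<Delta>(1)] Q_facts(3)[OF True] coeff[OF \<omega> True]])
      next
        case False
        \<comment> \<open>Frozen: \<open>U\<close> stays put, and every term added on the right is
          nonnegative.\<close>
        then have "U (Suc k) \<omega> = U k \<omega>" "g k \<omega> = 0"
          by (simp_all add: U_def \<xi>_def Zs g_def A'_def \<beta>'_def)
        moreover have "0 \<le> U k \<omega>" using U_bounds(1)[of k \<omega>] by linarith
        moreover have "U k \<omega> \<le> (1 + 12 * K * \<Delta>) * U k \<omega>"
          using calculation(3) K \<Delta> by (simp add: algebra_simps)
        moreover have "0 \<le> 192 * K * U k \<omega> * (norm (D k \<omega>))\<^sup>2" "0 \<le> 8 * C * a\<^sup>2 * norm (D k \<omega>) ^ 4"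
            "0 \<le> 32 * \<Delta>\<^sup>2 * b\<^sup>2 / \<epsilon>\<^sup>2" "0 \<le> 8 * C * \<Delta> ^ 4 * b ^ 4"
          using K nn calculation(3) by simp_all
        ultimately show ?thesis unfolding \<open>g k \<omega> = 0\<close> inner_zero_left by linarith
      qed
    qed
    have EU: "expectation (U (Suc k)) \<le> (1 + L * \<Delta>) * expectation (U k) + c * \<Delta>\<^sup>2" for k
    proof -
      have "expectation (U (Suc k)) \<le> expectation (\<lambda>\<omega>. (1 + 12 * K * \<Delta>) * U k \<omega>)
          + expectation (\<lambda>\<omega>. 192 * K * U k \<omega>) * (CARD('m) * (t (Suc k) - t k))
          + 8 * C * a\<^sup>2 * (3 * (real CARD('m))\<^sup>2 * (t (Suc k) - t k)\<^sup>2)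
          + (32 * \<Delta>\<^sup>2 * b\<^sup>2 / \<epsilon>\<^sup>2 + 8 * C * \<Delta> ^ 4 * b ^ 4)"
      proof (rule expectation_step_le[OF t0 t_lt g_F g_bound])
        show "(\<lambda>\<omega>. 192 * K * U k \<omega>) \<in> borel_measurable (F (t k))"
          by (intro borel_measurable_times borel_measurable_const U_F)
        show "0 \<le> 8 * C * a\<^sup>2" using nn by simp
      qed (use U_int[of k] U_int[of "Suc k"] step[of _ k] in \<open>simp_all add: D_def\<close>)
      also have "\<dots> = (1 + L * \<Delta>) * expectation (U k) + 8 * C * a\<^sup>2 * (3 * (real CARD('m))\<^sup>2) * \<Delta>\<^sup>2
          + 32 * b\<^sup>2 / \<epsilon>\<^sup>2 * \<Delta>\<^sup>2 + 8 * C * \<Delta>\<^sup>2 * b ^ 4 * \<Delta>\<^sup>2"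
        unfolding t_diff using U_int[of k] by (simp add: L_def algebra_simps power4_eq_xxxx power2_eq_square)
      \<comment> \<open>With this every remainder is a multiple of \<open>\<Delta>\<^sup>2\<close>;
        over \<open>n\<close> steps they add up to order \<open>1 / n\<close>.\<close>
      also have "8 * C * \<Delta>\<^sup>2 * b ^ 4 * \<Delta>\<^sup>2 \<le> 8 * C * T\<^sup>2 * b ^ 4 * \<Delta>\<^sup>2"
        using nn \<Delta> by (intro mult_right_mono mult_left_mono power_mono) auto
      finally show ?thesis by (simp add: c_def algebra_simps)
    qed
    have "expectation (U n) \<le> exp (L * \<Delta> * n) * (expectation (U 0) + c * \<Delta>\<^sup>2 * n)"
    proof (rule discrete_gronwall)
      show "0 \<le> expectation (U 0)"
        using U_bounds(1)[of 0] by (intro Bochner_Integration.integral_nonneg) (rule order_trans[OF zero_le_one])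
    qed (use nn c \<Delta> EU in simp_all)
    also have "L * \<Delta> * n = L * T" using n by (simp add: \<Delta>_def)
    also have "c * \<Delta>\<^sup>2 * n = c * T\<^sup>2 / n" using n by (simp add: \<Delta>_def power2_eq_square)
    also have "U 0 = (\<lambda>_. lyap ((norm z)\<^sup>2 + \<epsilon>\<^sup>2))"
      by (simp add: fun_eq_iff U_def \<xi>_def Z_def)
    also have "expectation (\<lambda>_. lyap ((norm z)\<^sup>2 + \<epsilon>\<^sup>2)) = lyap ((norm z)\<^sup>2 + \<epsilon>\<^sup>2)"
      by (simp add: prob_space)
    finally have EUn: "expectation (U n) \<le> exp (L * T) * (lyap ((norm z)\<^sup>2 + \<epsilon>\<^sup>2) + c * T\<^sup>2 / n)" .
    let ?E = "{\<omega>\<in>space M. (\<forall>k\<le>n. G (grid n k) \<omega>) \<and> (\<exists>k\<le>n. norm (\<eta> (grid n k) \<omega>) < \<epsilon>)} - euler_error n \<epsilon>"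
    let ?U = "{\<omega>\<in>space M. lyap (5 * \<epsilon>\<^sup>2) \<le> U n \<omega>}"
    have l5: "0 < lyap (5 * \<epsilon>\<^sup>2)" using lyap_ge_1[of "5 * \<epsilon>\<^sup>2"] \<epsilon> by simp
    have "?E \<subseteq> ?U"
    proof safe
      fix \<omega> k
      assume \<omega>: "\<omega> \<in> space M" and Gk: "\<forall>k\<le>n. G (grid n k) \<omega>" and k: "k \<le> n" "norm (\<eta> (grid n k) \<omega>) < \<epsilon>"
        and err: "\<omega> \<notin> euler_error n \<epsilon>"
      \<comment> \<open>At the first index \<open>l\<close> below \<open>\<epsilon>\<close> the sum
        freezes at the Euler value, of norm at most \<open>\<epsilon> + \<epsilon>\<close>. With the
        regularisation this gives \<open>4 * \<epsilon>\<^sup>2 + \<epsilon>\<^sup>2\<close>, the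
        origin of \<open>5 * \<epsilon>\<^sup>2\<close>.\<close>
      define l where "l = (LEAST k. norm (\<eta> (grid n k) \<omega>) < \<epsilon>)"
      have l: "norm (\<eta> (grid n l) \<omega>) < \<epsilon>" "l \<le> k"
        unfolding l_def using k(2) by (auto intro: LeastI Least_le)
      have l_n: "l \<le> n" using l(2) k(1) by linarith
      have close: "norm (euler n j \<omega> - \<eta> (grid n j) \<omega>) \<le> \<epsilon>" if "j \<le> n" for j
        using err \<omega> that by (auto simp: euler_error_def not_less)
      have "\<epsilon> \<le> norm (\<eta> (grid n j) \<omega>)" if "j < l" for j
        using not_less_Least[of j "\<lambda>k. norm (\<eta> (grid n k) \<omega>) < \<epsilon>"] that by (auto simp: l_def)
      then have Zl: "Z n \<omega> = euler n l \<omega>"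
        using l(1) l_n Gk close by (intro Z_stop) (auto simp: good_def t_def)
      have "norm (euler n l \<omega>) \<le> 2 * \<epsilon>"
        using close[OF l_n] l(1) norm_triangle_ineq2[of "euler n l \<omega>" "\<eta> (grid n l) \<omega>"] by linarith
      then have "(norm (Z n \<omega>))\<^sup>2 \<le> (2 * \<epsilon>)\<^sup>2"
        unfolding Zl by (intro power_mono) auto
      then have "\<xi> n \<omega> \<le> 5 * \<epsilon>\<^sup>2" by (simp add: \<xi>_def power_mult_distrib)
      then show "lyap (5 * \<epsilon>\<^sup>2) \<le> U n \<omega>"
        unfolding U_def by (intro lyap_antimono \<xi>_pos)
    qed
    moreover have "?U \<in> events"
    proof -
      note [measurable] = measurable_F_M[OF t0 U_F]
      show ?thesis by measurable
    qed
    ultimately have "prob ?E \<le> prob ?U" by (rule finite_measure_mono)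
    also have "\<dots> \<le> expectation (U n) / lyap (5 * \<epsilon>\<^sup>2)"
    proof (rule integral_Markov_inequality_measure[where A = "{}", OF U_int _ _ l5])
      show "AE \<omega> in M. 0 \<le> U n \<omega>"
        by (intro AE_I2 order_trans[OF zero_le_one U_bounds(1)])
    qed simp
    finally have "prob ?E * lyap (5 * \<epsilon>\<^sup>2) \<le> expectation (U n)"
      using l5 by (simp add: pos_le_divide_eq)
    with EUn show ?thesis by linarith
  qed
  show ?thesis
    by (rule exI[of _ "c * T\<^sup>2"]) (use bound in \<open>simp add: L_def\<close>)
qed

text \<open>For each \<open>j\<close> the paths in \<open>G j\<close> that come arbitrarily close to
  \<open>0\<close> satisfy \<open>prob (H j) * lyap (5 * \<epsilon>\<^sup>2) \<le> B\<close> with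
  \<open>B\<close> free of \<open>\<epsilon>\<close>, so they form a null set. \<open>K\<close> may
  grow with \<open>j\<close>, since the countably many \<open>j\<close> are settled one by
  one.\<close>

lemma avoids_zero:
  fixes G :: "nat \<Rightarrow> real \<Rightarrow> 'w \<Rightarrow> bool" and r :: "nat \<Rightarrow> real"
  assumes z: "z \<noteq> 0"
    and G: "\<And>j t. 0 \<le> t \<Longrightarrow> Measurable.pred (F t) (G j t)"
    and G_ex: "\<And>\<omega>. \<omega> \<in> space M \<Longrightarrow> \<exists>j. \<forall>t\<in>{0..T}. G j t \<omega>"
    and r: "\<And>j. 0 \<le> r j" and \<eta>_le: "\<And>j t \<omega>. 0 \<le> t \<Longrightarrow> \<omega> \<in> space M \<Longrightarrow> G j t \<omega> \<Longrightarrow> norm (\<eta> t \<omega>) \<le> r j"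
    and coeff: "\<And>j. \<exists>K\<ge>0. \<forall>t\<ge>0. \<forall>\<omega>\<in>space M. G j t \<omega> \<longrightarrow> \<eta> t \<omega> \<noteq> 0 \<longrightarrow>
      (norm (A t \<omega>))\<^sup>2 \<le> K * (norm (\<eta> t \<omega>))\<^sup>2 * lyap ((norm (\<eta> t \<omega>))\<^sup>2) \<and>
      norm (\<beta> t \<omega>) \<le> K * norm (\<eta> t \<omega>) * lyap ((norm (\<eta> t \<omega>))\<^sup>2)"
  shows "AE \<omega> in M. \<forall>t\<in>{0..T}. \<eta> t \<omega> \<noteq> 0"
proof -
  \<comment> \<open>Rational fractions of \<open>T\<close> rather than rational times:
    \<open>T * q\<close> then meets every grid point even for irrational \<open>T\<close>.
    Countability keeps the events measurable, and by continuity a zero at any time shows up as small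
    values at these times.\<close>
  let ?q = "\<rat> \<inter> {0..1::real}"
  define near where "near i \<omega> \<longleftrightarrow> (\<exists>q\<in>?q. norm (\<eta> (T * q) \<omega>) < 1 / real (Suc i))" for i \<omega>
  define H where "H j = {\<omega>\<in>space M. (\<forall>i. near i \<omega>) \<and> (\<forall>q\<in>?q. G j (T * q) \<omega>)}" for j
  have cq: "countable ?q" by (intro countable_Int1 countable_rat)
  have Tq: "0 \<le> T * q" "T * q \<le> T" if "q \<in> ?q" for q using that T_pos by (auto simp: mult_left_le)
  have near_M: "Measurable.pred M (near i)" for i
    unfolding near_def
  proof (rule measurable_pred_countable(2)[OF cq])
    fix q assume "q \<in> ?q"
    note [measurable] = \<eta>_measurable[OF Tq(1)[OF this]]
    show "Measurable.pred M (\<lambda>\<omega>. norm (\<eta> (T * q) \<omega>) < 1 / real (Suc i))" by measurable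
  qed
  have G_M: "Measurable.pred M (\<lambda>\<omega>. \<forall>q\<in>?q. G j (T * q) \<omega>)" for j
  proof (rule measurable_pred_countable(1)[OF cq])
    fix q assume "q \<in> ?q"
    then show "Measurable.pred M (\<lambda>\<omega>. G j (T * q) \<omega>)"
      by (intro measurable_F_M[OF Tq(1) G] Tq(1))
  qed
  have H_ev: "H j \<in> events" for j
  proof -
    note [measurable] = near_M G_M
    show ?thesis unfolding H_def by measurable
  qed
  have grid_q: "\<exists>q\<in>?q. grid n k = T * q" if "0 < n" "k \<le> n" for n k
    using that by (intro bexI[of _ "real k / real n"]) (auto simp: grid_def)
  have "prob (H j) = 0" for j
  proof -
    obtain K where K: "0 \<le> K"
      and A_le: "\<And>t \<omega>. 0 \<le> t \<Longrightarrow> \<omega> \<in> space M \<Longrightarrow> G j t \<omega> \<Longrightarrow> \<eta> t \<omega> \<noteq> 0 \<Longrightarrow>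
        (norm (A t \<omega>))\<^sup>2 \<le> K * (norm (\<eta> t \<omega>))\<^sup>2 * lyap ((norm (\<eta> t \<omega>))\<^sup>2)"
      and \<beta>_le: "\<And>t \<omega>. 0 \<le> t \<Longrightarrow> \<omega> \<in> space M \<Longrightarrow> G j t \<omega> \<Longrightarrow> \<eta> t \<omega> \<noteq> 0 \<Longrightarrow>
        norm (\<beta> t \<omega>) \<le> K * norm (\<eta> t \<omega>) * lyap ((norm (\<eta> t \<omega>))\<^sup>2)"
      using coeff[of j] by blast
    define B where "B = exp ((12 * K + 192 * K * CARD('m)) * T) * lyap ((norm z)\<^sup>2)"
    have bound: "prob (H j) * lyap (5 * \<epsilon>\<^sup>2) \<le> B" if \<epsilon>: "0 < \<epsilon>" for \<epsilon>
    proof -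
      obtain c where c: "\<And>n. 0 < n \<Longrightarrow>
          prob ({\<omega>\<in>space M. (\<forall>k\<le>n. G j (grid n k) \<omega>) \<and> (\<exists>k\<le>n. norm (\<eta> (grid n k) \<omega>) < \<epsilon>)} - euler_error n \<epsilon>)
            * lyap (5 * \<epsilon>\<^sup>2)
          \<le> exp ((12 * K + 192 * K * CARD('m)) * T) * (lyap ((norm z)\<^sup>2 + \<epsilon>\<^sup>2) + c / n)"
        using euler_lyapunov[of "G j" K "r j" \<epsilon>, OF G K r \<epsilon> A_le \<beta>_le \<eta>_le] by blast
      define E where "E n = {\<omega>\<in>space M. \<exists>k\<le>n. norm (\<eta> (grid n k) \<omega>) < \<epsilon>}" for n
      have E_ev: "E n \<in> events" for n
      proof -
        note [measurable] = \<eta>_measurable[OF grid_nonneg]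
        show ?thesis unfolding E_def by measurable
      qed
      \<comment> \<open>A path in \<open>H j\<close> falls below \<open>\<epsilon>\<close> at some
        \<open>T * q\<close>. By continuity it does so at nearby grid points too, once the mesh is
        fine.\<close>
      have HE: "(\<lambda>n. prob (H j - E n)) \<longlonglongrightarrow> 0"
      proof (rule prob_tendsto_0)
        show "H j - E n \<in> events" for n by (rule sets.Diff[OF H_ev E_ev])
      next
        fix \<omega> assume \<omega>: "\<omega> \<in> space M"
        show "\<forall>\<^sub>F n in sequentially. \<omega> \<notin> H j - E n"
        proof (cases "\<omega> \<in> H j")
          case True
          obtain i where i: "1 / real (Suc i) < \<epsilon>" using \<epsilon> by (metis nat_approx_posE)
          from True have "near i \<omega>" by (simp add: H_def)
          then obtain q where q: "q \<in> ?q" "norm (\<eta> (T * q) \<omega>) < 1 / real (Suc i)"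
            unfolding near_def by blast
          have cont: "continuous_on {0..} (\<lambda>t. \<eta> t \<omega>)" by (rule \<eta>_cont[OF \<omega>])
          have q0: "0 \<le> q" "q \<le> 1" using q(1) by auto
          \<comment> \<open>Rounding down picks the grid point at or just before
            \<open>T * q\<close>, so the index is at most \<open>n\<close>.\<close>
          obtain k :: "nat \<Rightarrow> nat" where k: "\<And>n. real (k n) \<le> q * real n" "\<And>n. q * real n - 1 \<le> real (k n)"
          proof (rule that[of "\<lambda>n. nat \<lfloor>q * real n\<rfloor>"])
            fix n :: nat
            have "0 \<le> q * real n" using q0 by simp
            then show "real (nat \<lfloor>q * real n\<rfloor>) \<le> q * real n" "q * real n - 1 \<le> real (nat \<lfloor>q * real n\<rfloor>)"
              by linarith+
          qed
          have "(\<lambda>n. real (k n) / real n) \<longlonglongrightarrow> q"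
          proof (rule tendsto_sandwich[of "\<lambda>n. q - 1 / real n" _ _ "\<lambda>_. q"])
            show "\<forall>\<^sub>F n in sequentially. q - 1 / real n \<le> real (k n) / real n"
              using eventually_gt_at_top[of "0::nat"]
            proof eventually_elim
              case (elim n)
              have "(q * real n - 1) / real n \<le> real (k n) / real n"
                by (rule divide_right_mono[OF k(2)]) simp
              then show ?case using elim by (simp add: diff_divide_distrib)
            qed
            show "\<forall>\<^sub>F n in sequentially. real (k n) / real n \<le> q"
              using eventually_gt_at_top[of "0::nat"]
            proof eventually_elim
              case (elim n)
              show ?case using k(1)[of n] elim by (simp add: pos_divide_le_eq)
            qed
            show "(\<lambda>n. q - 1 / real n) \<longlonglongrightarrow> q"
              using tendsto_diff[OF tendsto_const lim_1_over_n, of q] by simp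
          qed (rule tendsto_const)
          then have lim: "(\<lambda>n. T * (real (k n) / real n)) \<longlonglongrightarrow> T * q"
            by (intro tendsto_mult tendsto_const)
          have "(\<lambda>n. norm (\<eta> (T * (real (k n) / real n)) \<omega>)) \<longlonglongrightarrow> norm (\<eta> (T * q) \<omega>)"
            using T_pos q0
            by (intro tendsto_norm continuous_on_tendsto_compose[OF cont lim]) (auto intro!: always_eventually)
          then have "\<forall>\<^sub>F n in sequentially. norm (\<eta> (T * (real (k n) / real n)) \<omega>) < \<epsilon>"
            by (rule order_tendstoD(2)[OF _ less_trans[OF q(2) i]])
          then show ?thesis
          proof eventually_elim
            case (elim n)
            have "q * real n \<le> 1 * real n" using q0 by (intro mult_right_mono) auto
            then have "k n \<le> n" using k(1)[of n] by linarith
            moreover have "norm (\<eta> (grid n (k n)) \<omega>) < \<epsilon>" using elim by (simp add: grid_def)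
            ultimately have "\<omega> \<in> E n" using \<omega> unfolding E_def by blast
            then show ?case by simp
          qed
        qed simp
      qed
      have "\<forall>\<^sub>F n in sequentially. prob (H j) * lyap (5 * \<epsilon>\<^sup>2) \<le>
          (prob (H j - E n) + prob (euler_error n \<epsilon>)) * lyap (5 * \<epsilon>\<^sup>2) +
          exp ((12 * K + 192 * K * CARD('m)) * T) * (lyap ((norm z)\<^sup>2 + \<epsilon>\<^sup>2) + c / n)"
        using eventually_gt_at_top[of "0::nat"]
      proof eventually_elim
        case (elim n)
        let ?P = "{\<omega>\<in>space M. (\<forall>k\<le>n. G j (grid n k) \<omega>) \<and> (\<exists>k\<le>n. norm (\<eta> (grid n k) \<omega>) < \<epsilon>)} - euler_error n \<epsilon>"
        have P_ev: "?P \<in> events"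
        proof -
          note [measurable] = \<eta>_measurable[OF grid_nonneg] measurable_F_M[OF grid_nonneg G[OF grid_nonneg]]
            euler_error_event[OF elim]
          show ?thesis by measurable
        qed
        \<comment> \<open>Apart from paths whose approach to \<open>0\<close> the grid misses and
          paths with a large Euler error, only the event estimated by \<open>euler_lyapunov\<close>
          remains.\<close>
        have "H j \<subseteq> (H j - E n) \<union> euler_error n \<epsilon> \<union> ?P"
        proof
          fix \<omega> assume h: "\<omega> \<in> H j"
          then have "\<forall>k\<le>n. G j (grid n k) \<omega>"
            using grid_q[OF elim] by (force simp: H_def)
          moreover have "\<omega> \<in> space M" using h by (simp add: H_def)
          ultimately show "\<omega> \<in> (H j - E n) \<union> euler_error n \<epsilon> \<union> ?P"
            using h by (simp add: E_def) blast
        qed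
        then have "prob (H j) \<le> prob ((H j - E n) \<union> euler_error n \<epsilon> \<union> ?P)"
          using sets.Un[OF sets.Un[OF sets.Diff[OF H_ev E_ev] euler_error_event[OF elim]] P_ev]
          by (rule finite_measure_mono)
        also have "\<dots> \<le> prob ((H j - E n) \<union> euler_error n \<epsilon>) + prob ?P"
          by (rule measure_Un_le[OF sets.Un[OF sets.Diff[OF H_ev E_ev] euler_error_event[OF elim]] P_ev])
        also have "prob ((H j - E n) \<union> euler_error n \<epsilon>) \<le> prob (H j - E n) + prob (euler_error n \<epsilon>)"
          by (rule measure_Un_le[OF sets.Diff[OF H_ev E_ev] euler_error_event[OF elim]])
        finally have "prob (H j) * lyap (5 * \<epsilon>\<^sup>2) \<le>
            (prob (H j - E n) + prob (euler_error n \<epsilon>) + prob ?P) * lyap (5 * \<epsilon>\<^sup>2)"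
          using lyap_ge_1[of "5 * \<epsilon>\<^sup>2"] \<epsilon> by (intro mult_right_mono) auto
        then show ?case using c[OF elim] unfolding distrib_right by linarith
      qed
      \<comment> \<open>With \<open>\<epsilon>\<close> fixed, the two error probabilities and
        \<open>c / n\<close> disappear in the limit.\<close>
      moreover have "(\<lambda>n. (prob (H j - E n) + prob (euler_error n \<epsilon>)) * lyap (5 * \<epsilon>\<^sup>2) +
          exp ((12 * K + 192 * K * CARD('m)) * T) * (lyap ((norm z)\<^sup>2 + \<epsilon>\<^sup>2) + c / n)) \<longlonglongrightarrow>
          (0 + 0) * lyap (5 * \<epsilon>\<^sup>2) + exp ((12 * K + 192 * K * CARD('m)) * T) * (lyap ((norm z)\<^sup>2 + \<epsilon>\<^sup>2) + 0)"
        by (intro tendsto_add tendsto_mult tendsto_const HE euler_error_tendsto_0[OF \<epsilon>] lim_const_over_n)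
      ultimately have "prob (H j) * lyap (5 * \<epsilon>\<^sup>2) \<le> exp ((12 * K + 192 * K * CARD('m)) * T) * lyap ((norm z)\<^sup>2 + \<epsilon>\<^sup>2)"
        using tendsto_le[OF sequentially_bot _ tendsto_const] by fastforce
      also have "\<dots> \<le> B"
        unfolding B_def using z by (intro mult_left_mono lyap_antimono) auto
      finally show ?thesis .
    qed
    show ?thesis
    proof (rule ccontr)
      assume "prob (H j) \<noteq> 0"
      then have p: "0 < prob (H j)" by (simp add: zero_less_measure_iff)
      \<comment> \<open>Since \<open>lyap (1 / y) \<ge> 1 + ln y\<close>, taking
        \<open>5 * \<epsilon>\<^sup>2 = 1 / y\<close> makes
        \<open>lyap (5 * \<epsilon>\<^sup>2)\<close> exceed \<open>B / prob (H j)\<close>.\<close>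
      define y where "y = exp (B / prob (H j))"
      define \<epsilon> where "\<epsilon> = sqrt (1 / (5 * y))"
      have y: "0 < y" by (simp add: y_def)
      have \<epsilon>: "0 < \<epsilon>" "5 * \<epsilon>\<^sup>2 = 1 / y" using y by (simp_all add: \<epsilon>_def)
      have "B / prob (H j) < lyap (5 * \<epsilon>\<^sup>2)"
      proof -
        have "ln y \<le> ln (1 + y)" using y by (intro ln_mono) auto
        then show ?thesis unfolding \<epsilon>(2) lyap_def by (simp add: y_def)
      qed
      then show False using bound[OF \<epsilon>(1)] p by (simp add: divide_less_eq mult.commute)
    qed
  qed
  then have "H j \<in> null_sets M" for j
    using H_ev by (simp add: null_sets_def emeasure_eq_measure)
  then have "(\<Union>j. H j) \<in> null_sets M" by blast
  then show ?thesis
  proof (rule AE_I', intro subsetI UN_I)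
    fix \<omega> assume "\<omega> \<in> {\<omega>\<in>space M. \<not> (\<forall>t\<in>{0..T}. \<eta> t \<omega> \<noteq> 0)}"
    then obtain t where \<omega>: "\<omega> \<in> space M" and t: "t \<in> {0..T}" "\<eta> t \<omega> = 0" by auto
    define j where "j = (SOME j. \<forall>t\<in>{0..T}. G j t \<omega>)"
    have j: "\<forall>t\<in>{0..T}. G j t \<omega>" unfolding j_def by (rule someI_ex[OF G_ex[OF \<omega>]])
    have "near i \<omega>" for i
    proof -
      define s where "s = t / T"
      have s: "s \<in> {0..1}" "T * s = t" using t T_pos by (auto simp: s_def field_simps)
      have cont: "continuous_on {0..1} (\<lambda>q. norm (\<eta> (T * q) \<omega>))"
        using T_pos by (intro continuous_on_norm continuous_on_compose2[OF \<eta>_cont[OF \<omega>]] continuous_intros) auto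
      obtain d where d: "0 < d" "\<And>q. q \<in> {0..1} \<Longrightarrow> dist q s < d \<Longrightarrow>
          dist (norm (\<eta> (T * q) \<omega>)) (norm (\<eta> (T * s) \<omega>)) < 1 / real (Suc i)"
        using cont s(1) unfolding continuous_on_iff by (metis of_nat_0_less_iff zero_less_Suc zero_less_divide_1_iff)
      \<comment> \<open>The interval is cut to the unit interval because \<open>s\<close> may be one
        of its end points.\<close>
      have "\<exists>q\<in>\<rat>. max 0 (s - d) < q \<and> q < min 1 (s + d)"
        using s(1) d(1) by (intro Rats_dense_in_real) (auto simp: max_def min_def)
      then obtain q where "q \<in> \<rat>" "0 < q" "q < 1" "s - d < q" "q < s + d" by auto
      then have "q \<in> ?q" "dist q s < d" by (auto simp: dist_real_def)
      then show ?thesis using d(2)[of q] s(2) t(2) by (auto simp: near_def)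
    qed
    moreover have "G j (T * q) \<omega>" if "q \<in> ?q" for q using j Tq[OF that] by auto
    ultimately show "\<omega> \<in> H j" using \<omega> by (auto simp: H_def)
  qed simp
qed

end

section \<open>Solutions of the stochastic differential equation\<close>

lemma conv_in_prob_cong:
  assumes "\<And>n \<omega>. \<omega> \<in> space M \<Longrightarrow> S n \<omega> - I \<omega> = S' n \<omega> - I' \<omega>"
  shows "conv_in_prob M S I \<longleftrightarrow> conv_in_prob M S' I'"
proof -
  have "{\<omega>\<in>space M. norm (S n \<omega> - I \<omega>) > e} = {\<omega>\<in>space M. norm (S' n \<omega> - I' \<omega>) > e}" for n e
    using assms by auto
  then show ?thesis by (simp add: conv_in_prob_def)
qed

lemma (in prob_space) conv_in_prob_diff:
  fixes S S' :: "nat \<Rightarrow> 'a \<Rightarrow> 'b::euclidean_space"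
  assumes conv: "conv_in_prob M S I" "conv_in_prob M S' I'"
    and meas: "\<And>n. S n \<in> borel_measurable M" "\<And>n. S' n \<in> borel_measurable M"
      "I \<in> borel_measurable M" "I' \<in> borel_measurable M"
  shows "conv_in_prob M (\<lambda>n \<omega>. S n \<omega> - S' n \<omega>) (\<lambda>\<omega>. I \<omega> - I' \<omega>)"
  unfolding conv_in_prob_def
proof (intro allI impI)
  fix e :: real assume e: "0 < e"
  let ?A = "\<lambda>n. {\<omega>\<in>space M. norm (S n \<omega> - I \<omega>) > e / 2}"
  let ?B = "\<lambda>n. {\<omega>\<in>space M. norm (S' n \<omega> - I' \<omega>) > e / 2}"
  let ?C = "\<lambda>n. {\<omega>\<in>space M. norm (S n \<omega> - S' n \<omega> - (I \<omega> - I' \<omega>)) > e}"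
  note [measurable] = meas
  have ev: "?A n \<in> events" "?B n \<in> events" for n by measurable
  have "(\<lambda>n. prob (?A n) + prob (?B n)) \<longlonglongrightarrow> 0 + 0"
    by (intro tendsto_add conv[unfolded conv_in_prob_def, rule_format] half_gt_zero e)
  then have lim: "(\<lambda>n. prob (?A n) + prob (?B n)) \<longlonglongrightarrow> 0" by simp
  have "prob (?C n) \<le> prob (?A n) + prob (?B n)" for n
  proof -
    have "?C n \<subseteq> ?A n \<union> ?B n"
    proof
      fix \<omega> assume \<omega>: "\<omega> \<in> ?C n"
      have eq: "S n \<omega> - S' n \<omega> - (I \<omega> - I' \<omega>) = (S n \<omega> - I \<omega>) - (S' n \<omega> - I' \<omega>)" by simp
      have "e < norm ((S n \<omega> - I \<omega>) - (S' n \<omega> - I' \<omega>))"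
        using \<omega> unfolding mem_Collect_eq eq by (rule conjunct2)
      then have "norm (S n \<omega> - I \<omega>) > e / 2 \<or> norm (S' n \<omega> - I' \<omega>) > e / 2"
        using norm_triangle_ineq4[of "S n \<omega> - I \<omega>" "S' n \<omega> - I' \<omega>"] by argo
      then show "\<omega> \<in> ?A n \<union> ?B n" using \<omega> by blast
    qed
    then have "prob (?C n) \<le> prob (?A n \<union> ?B n)"
      by (rule finite_measure_mono[OF _ sets.Un[OF ev]])
    also have "\<dots> \<le> prob (?A n) + prob (?B n)" by (rule measure_Un_le[OF ev])
    finally show ?thesis .
  qed
  then show "(\<lambda>n. prob (?C n)) \<longlonglongrightarrow> 0"
    by (intro tendsto_sandwich[OF _ _ tendsto_const lim] always_eventually allI measure_nonneg)
qed

context filtered_brownian_motion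
begin

text \<open>\<open>I\<close> need not be measurable, and \<open>measure\<close> is \<open>0\<close>
  on non-measurable sets. Completeness settles this: the events for \<open>I\<close> and
  \<open>I'\<close> differ only within a null set, so both are measurable with equal
  probability.\<close>

lemma conv_in_prob_cong_AE:
  fixes S :: "nat \<Rightarrow> 'w \<Rightarrow> 'b::euclidean_space"
  assumes conv: "conv_in_prob M S I" and eq: "AE \<omega> in M. I \<omega> = I' \<omega>"
    and meas: "\<And>n. S n \<in> borel_measurable M" "I' \<in> borel_measurable M"
  shows "conv_in_prob M S I'"
proof -
  obtain N where N: "N \<in> null_sets M" "{\<omega>\<in>space M. I \<omega> \<noteq> I' \<omega>} \<subseteq> N"
    using eq unfolding eventually_ae_filter by blast
  have "prob {\<omega>\<in>space M. norm (S n \<omega> - I \<omega>) > e} = prob {\<omega>\<in>space M. norm (S n \<omega> - I' \<omega>) > e}" for n e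
  proof -
    let ?A = "{\<omega>\<in>space M. norm (S n \<omega> - I \<omega>) > e}" and ?B = "{\<omega>\<in>space M. norm (S n \<omega> - I' \<omega>) > e}"
    note [measurable] = meas
    have B: "?B \<in> events" by measurable
    have AN: "?A \<inter> N \<in> events" by (rule null_subset_event[OF N(1)]) blast
    have "?A = (?B - N) \<union> (?A \<inter> N)" using N(2) by auto
    then have A: "?A \<in> events" using sets.Un[OF sets.Diff[OF B null_setsD2[OF N(1)]] AN] by simp
    show ?thesis
      by (rule finite_measure_eq_AE[OF _ A B]) (use eq in \<open>auto elim: eventually_mono\<close>)
  qed
  then show ?thesis using conv by (simp add: conv_in_prob_def)
qed

text \<open>The stochastic integral in a solution is only known as a limit in probability and need not be
  measurable, so it is replaced by the measurable process that equals it almost surely.\<close>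

lemma sde_solution_conv:
  fixes \<sigma> :: "real ^ 'd \<Rightarrow> real ^ 'm ^ 'd" and b :: "real ^ 'd \<Rightarrow> real ^ 'd"
  assumes \<sigma>: "continuous_on UNIV \<sigma>" and b: "continuous_on UNIV b"
    and X: "sde_solution M F W \<sigma> b z X" and t: "0 \<le> t"
  defines "S \<equiv> \<lambda>n \<omega>. \<Sum>k<n. \<sigma> (X (t * real k / real n) \<omega>) *v
    (W (t * real (Suc k) / real n) \<omega> - W (t * real k / real n) \<omega>)"
    and "I \<equiv> \<lambda>\<omega>. X t \<omega> - z - integral {0..t} (\<lambda>s. b (X s \<omega>))"
  shows "S n \<in> borel_measurable M" and "I \<in> borel_measurable M" and "conv_in_prob M S I"
proof -
  have XM: "X s \<in> borel_measurable M" if "0 \<le> s" for s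
    using X that by (intro measurable_F_M[OF that]) (simp add: sde_solution_def)
  have X_cont: "continuous_on {0..} (\<lambda>s. X s \<omega>)" if "\<omega> \<in> space M" for \<omega>
    using X that by (simp add: sde_solution_def)
  have \<sigma>X: "(\<lambda>\<omega>. \<sigma> (X s \<omega>)) \<in> borel_measurable M" if "0 \<le> s" for s
    by (rule measurable_compose[OF XM[OF that] borel_measurable_continuous_onI[OF \<sigma>]])
  have bX: "(\<lambda>\<omega>. b (X s \<omega>)) \<in> borel_measurable M" if "0 \<le> s" for s
    by (rule measurable_compose[OF XM[OF that] borel_measurable_continuous_onI[OF b]])
  show S: "S n \<in> borel_measurable M" for n
    unfolding S_def using t
    by (intro borel_measurable_sum borel_measurable_matrix_vector_mult borel_measurable_diff \<sigma>X W_measurable) auto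
  have int: "(\<lambda>\<omega>. integral {0..t} (\<lambda>s. b (X s \<omega>))) \<in> borel_measurable M"
    by (rule integral_continuous_process_measurable[OF t bX])
      (auto intro!: continuous_on_compose2[OF b] continuous_on_subset[OF X_cont])
  show I: "I \<in> borel_measurable M"
    unfolding I_def by (intro borel_measurable_diff borel_measurable_const XM t int)
  obtain I0 where I0: "conv_in_prob M S I0"
    "AE \<omega> in M. X t \<omega> = z + integral {0..t} (\<lambda>s. b (X s \<omega>)) + I0 \<omega>"
    using X t unfolding sde_solution_def S_def by blast
  show "conv_in_prob M S I"
  proof (rule conv_in_prob_cong_AE[OF I0(1) _ S I])
    show "AE \<omega> in M. I0 \<omega> = I \<omega>"
      using I0(2) by eventually_elim (simp add: I_def)
  qed
qed

end

theorem theorem2p5: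
  fixes M :: "'w measure" and F :: "real \<Rightarrow> 'w measure"
    and W :: "real \<Rightarrow> 'w \<Rightarrow> real ^ 'm"
    and \<sigma> :: "real ^ 'd \<Rightarrow> real ^ 'm ^ 'd" and b :: "real ^ 'd \<Rightarrow> real ^ 'd"
    and T C \<mu> :: real and x y :: "real ^ 'd"
    and X Y :: "real \<Rightarrow> 'w \<Rightarrow> real ^ 'd"
  assumes "prob_space M"
    and "usual_filtration M F"
    and "brownian_motion M F W"
    and "T > 0"
    and "continuous_on UNIV \<sigma>" and "continuous_on UNIV b"
    and "C > 0" and "\<mu> > 0"
    and "\<And>(N::nat) u v. real N > exp 1 \<Longrightarrow> norm u \<le> real N \<Longrightarrow> norm v \<le> real N \<Longrightarrow>
           norm (\<sigma> u - \<sigma> v) \<le> C * sqrt (ln (real N)) * norm (u - v) + C * ln (real N) / real N powr \<mu>"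
    and "\<And>(N::nat) u v. real N > exp 1 \<Longrightarrow> norm u \<le> real N \<Longrightarrow> norm v \<le> real N \<Longrightarrow>
           norm (b u - b v) \<le> C * ln (real N) * norm (u - v) + C * ln (real N) / real N powr \<mu>"
    and "sde_solution M F W \<sigma> b x X"
    and "sde_solution M F W \<sigma> b y Y"
    and "x \<noteq> y"
  shows "AE \<omega> in M. \<forall>t\<in>{0..T}. X t \<omega> \<noteq> Y t \<omega>"
proof -
  interpret prob_space M by fact
  interpret filtered_brownian_motion M F W
    by unfold_locales fact+
  note \<sigma> = assms(5) and b = assms(6) and X = assms(11) and Y = assms(12)
  \<comment> \<open>The driving noise is common, so subtracting the equations gives an Ito process
    whose coefficients are the differences.\<close>
  define A where "A t \<omega> = \<sigma> (X t \<omega>) - \<sigma> (Y t \<omega>)" for t \<omega>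
  define \<beta> where "\<beta> t \<omega> = b (X t \<omega>) - b (Y t \<omega>)" for t \<omega>
  define \<eta> where "\<eta> t \<omega> = X t \<omega> - Y t \<omega>" for t \<omega>
  have XF: "X t \<in> borel_measurable (F t)" and YF: "Y t \<in> borel_measurable (F t)" if "0 \<le> t" for t
    using X Y that by (simp_all add: sde_solution_def)
  have Xc: "continuous_on {0..} (\<lambda>t. X t \<omega>)" and Yc: "continuous_on {0..} (\<lambda>t. Y t \<omega>)"
    if "\<omega> \<in> space M" for \<omega>
    using X Y that by (simp_all add: sde_solution_def)
  have bXc: "continuous_on {0..} (\<lambda>t. b (X t \<omega>))" and bYc: "continuous_on {0..} (\<lambda>t. b (Y t \<omega>))"
    if "\<omega> \<in> space M" for \<omega>
    using Xc[OF that] Yc[OF that] by (auto intro: continuous_on_compose2[OF b])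
  have \<sigma>Xc: "continuous_on {0..} (\<lambda>t. \<sigma> (X t \<omega>))" and \<sigma>Yc: "continuous_on {0..} (\<lambda>t. \<sigma> (Y t \<omega>))"
    if "\<omega> \<in> space M" for \<omega>
    using Xc[OF that] Yc[OF that] by (auto intro: continuous_on_compose2[OF \<sigma>])
  have conv: "conv_in_prob M
      (\<lambda>n \<omega>. \<Sum>k<n. A (t * real k / real n) \<omega> *v
        (W (t * real (Suc k) / real n) \<omega> - W (t * real k / real n) \<omega>))
      (\<lambda>\<omega>. \<eta> t \<omega> - (x - y) - integral {0..t} (\<lambda>s. \<beta> s \<omega>))" if t: "0 \<le> t" for t
  proof -
    note cX = sde_solution_conv[OF \<sigma> b X t] and cY = sde_solution_conv[OF \<sigma> b Y t]
    show ?thesis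
    proof (rule iffD1[OF conv_in_prob_cong conv_in_prob_diff[OF cX(3) cY(3) cX(1) cY(1) cX(2) cY(2)]])
      fix n \<omega> assume \<omega>: "\<omega> \<in> space M"
      have "(\<lambda>s. b (X s \<omega>)) integrable_on {0..t}" "(\<lambda>s. b (Y s \<omega>)) integrable_on {0..t}"
        by (auto intro!: integrable_continuous_real continuous_on_subset[OF bXc[OF \<omega>]] continuous_on_subset[OF bYc[OF \<omega>]])
      then have int: "integral {0..t} (\<lambda>s. \<beta> s \<omega>) =
          integral {0..t} (\<lambda>s. b (X s \<omega>)) - integral {0..t} (\<lambda>s. b (Y s \<omega>))"
        unfolding \<beta>_def by (rule Henstock_Kurzweil_Integration.integral_diff)
      show "(\<Sum>k<n. \<sigma> (X (t * real k / real n) \<omega>) *v (W (t * real (Suc k) / real n) \<omega> - W (t * real k / real n) \<omega>)) -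
          (\<Sum>k<n. \<sigma> (Y (t * real k / real n) \<omega>) *v (W (t * real (Suc k) / real n) \<omega> - W (t * real k / real n) \<omega>)) -
          (X t \<omega> - x - integral {0..t} (\<lambda>s. b (X s \<omega>)) - (Y t \<omega> - y - integral {0..t} (\<lambda>s. b (Y s \<omega>)))) =
          (\<Sum>k<n. A (t * real k / real n) \<omega> *v (W (t * real (Suc k) / real n) \<omega> - W (t * real k / real n) \<omega>)) -
          (\<eta> t \<omega> - (x - y) - integral {0..t} (\<lambda>s. \<beta> s \<omega>))"
        unfolding int A_def \<eta>_def sum_subtractf[symmetric] matrix_vector_mult_diff_rdistrib by simp
    qed
  qed
  interpret ito_process M F W T A \<beta> \<eta> "x - y"
  proof unfold_locales
    fix t :: real assume t: "0 \<le> t"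
    note m = XF[OF t] YF[OF t]
    show "A t \<in> borel_measurable (F t)"
      unfolding A_def by (intro borel_measurable_diff measurable_compose[OF m(1)] measurable_compose[OF m(2)]
          borel_measurable_continuous_onI \<sigma>)
    show "\<beta> t \<in> borel_measurable (F t)"
      unfolding \<beta>_def by (intro borel_measurable_diff measurable_compose[OF m(1)] measurable_compose[OF m(2)]
          borel_measurable_continuous_onI b)
    show "\<eta> t \<in> borel_measurable (F t)"
      unfolding \<eta>_def by (intro borel_measurable_diff m)
  next
    fix \<omega> assume \<omega>: "\<omega> \<in> space M"
    show "continuous_on {0..} (\<lambda>t. A t \<omega>)" "continuous_on {0..} (\<lambda>t. \<beta> t \<omega>)" "continuous_on {0..} (\<lambda>t. \<eta> t \<omega>)"
      unfolding A_def \<beta>_def \<eta>_def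
      by (intro continuous_on_diff \<sigma>Xc \<sigma>Yc bXc bYc Xc Yc \<omega>)+
  qed (fact assms conv)+
  \<comment> \<open>Every path is bounded on \<open>{0..T}\<close>, so some integer radius fits it,
    and on each ball \<open>log_lipschitz_modulus\<close> supplies a constant.\<close>
  define G where "G j t \<omega> \<longleftrightarrow> norm (X t \<omega>) \<le> real j \<and> norm (Y t \<omega>) \<le> real j" for j :: nat and t \<omega>
  have "AE \<omega> in M. \<forall>t\<in>{0..T}. \<eta> t \<omega> \<noteq> 0"
  proof (rule avoids_zero[where G = G and r = "\<lambda>j. 2 * real j"])
    show "x - y \<noteq> 0" using assms(13) by simp
    show "Measurable.pred (F t) (G j t)" if "0 \<le> t" for j t
    proof -
      note [measurable] = XF[OF that] YF[OF that]
      show ?thesis unfolding G_def by measurable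
    qed
    show "\<exists>j. \<forall>t\<in>{0..T}. G j t \<omega>" if \<omega>: "\<omega> \<in> space M" for \<omega>
    proof -
      have "bounded ((\<lambda>t. X t \<omega>) ` {0..T})" "bounded ((\<lambda>t. Y t \<omega>) ` {0..T})"
        by (auto intro!: compact_imp_bounded compact_continuous_image
            continuous_on_subset[OF Xc[OF \<omega>]] continuous_on_subset[OF Yc[OF \<omega>]])
      then obtain B B' where B: "\<And>t. t \<in> {0..T} \<Longrightarrow> norm (X t \<omega>) \<le> B" "\<And>t. t \<in> {0..T} \<Longrightarrow> norm (Y t \<omega>) \<le> B'"
        unfolding bounded_iff by blast
      obtain j :: nat where j: "max B B' \<le> real j" using real_arch_simple by blast
      have "G j t \<omega>" if "t \<in> {0..T}" for t
        using B[OF that] j unfolding G_def by linarith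
      then show ?thesis by blast
    qed
    show "norm (\<eta> t \<omega>) \<le> 2 * real j" if "G j t \<omega>" for j t \<omega>
      using that norm_triangle_ineq4[of "X t \<omega>" "Y t \<omega>"] unfolding G_def \<eta>_def by linarith
    show "\<exists>K\<ge>0. \<forall>t\<ge>0. \<forall>\<omega>\<in>space M. G j t \<omega> \<longrightarrow> \<eta> t \<omega> \<noteq> 0 \<longrightarrow>
        (norm (A t \<omega>))\<^sup>2 \<le> K * (norm (\<eta> t \<omega>))\<^sup>2 * lyap ((norm (\<eta> t \<omega>))\<^sup>2) \<and>
        norm (\<beta> t \<omega>) \<le> K * norm (\<eta> t \<omega>) * lyap ((norm (\<eta> t \<omega>))\<^sup>2)" for j
    proof -
      obtain K where "0 \<le> K" and "\<forall>u v. norm u \<le> real j \<longrightarrow> norm v \<le> real j \<longrightarrow> u \<noteq> v \<longrightarrow>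
          (norm (\<sigma> u - \<sigma> v))\<^sup>2 \<le> K * (norm (u - v))\<^sup>2 * lyap ((norm (u - v))\<^sup>2) \<and>
          norm (b u - b v) \<le> K * norm (u - v) * lyap ((norm (u - v))\<^sup>2)"
        using log_lipschitz_modulus[of "real j", OF of_nat_0_le_iff assms(7-10)] by blast
      then show ?thesis
        by (intro exI[of _ K]) (auto simp: G_def A_def \<beta>_def \<eta>_def)
    qed
  qed simp
  then show ?thesis
    by (auto simp: \<eta>_def elim!: eventually_mono)
qed

end
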